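(* Let $p$ be a prime and let $G$ be a finite $p$-group satisfying $|G:G'| = p^2$. If $|G| \ge p^6$ and $|\gamma_3(G):\gamma_4(G)| > p$ (equivalently, $|G:\gamma_4(G)| = p^5$), then $G$ has an irreducible complex character of degree $p^2$.
   Context: $G'$ denotes the commutator subgroup of $G$, and $\gamma_i(G)$ denotes the $i$-th term of the lower central series of $G$: $\gamma_1(G)=G$, $\gamma_2(G)=G'$, $\gamma_{i+1}(G)=[\gamma_i(G),G]$. Characters are ordinary (complex) characters. *)

theory Defs
  imports
    "HOL-Algebra.Generated_Groups"
    "HOL-Computational_Algebra.Primes"
    "Jordan_Normal_Form.VS_Connect"
begin

definition finite_p_group :: "nat \<Rightarrow> ('a, 'b) monoid_scheme \<Rightarrow> bool" where
  "finite_p_group p G \<longleftrightarrow>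
     group G \<and> finite (carrier G) \<and> (\<exists>n. Coset.order G = p ^ n)"

(* Same commutator convention x y x^-1 y^-1 as in the constant derived_set; the generated
   subgroup [H, K] does not depend on the convention when H and K are subgroups. *)
definition commutator_subgroup :: "('a, 'b) monoid_scheme \<Rightarrow> 'a set \<Rightarrow> 'a set \<Rightarrow> 'a set" where
  "commutator_subgroup G H K =
     generate G (\<Union>h\<in>H. \<Union>k\<in>K. {h \<otimes>\<^bsub>G\<^esub> k \<otimes>\<^bsub>G\<^esub> (inv\<^bsub>G\<^esub> h) \<otimes>\<^bsub>G\<^esub> (inv\<^bsub>G\<^esub> k)})"

(* Indexed from 1, i.e. lower_central G 1 = carrier G. The value at 0 is a dummy
   (again carrier G). *)
definition lower_central :: "('a, 'b) monoid_scheme \<Rightarrow> nat \<Rightarrow> 'a set" where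
  "lower_central G i = ((\<lambda>H. commutator_subgroup G H (carrier G)) ^^ (i - 1)) (carrier G)"

lemma lower_central_1: "lower_central G 1 = carrier G"
  by (simp add: lower_central_def)

lemma lower_central_2: "lower_central G 2 = derived G (carrier G)"
  by (simp add: lower_central_def commutator_subgroup_def derived_def)

lemma lower_central_Suc:
  "i \<ge> 1 \<Longrightarrow> lower_central G (Suc i) = commutator_subgroup G (lower_central G i) (carrier G)"
  by (cases i) (simp_all add: lower_central_def)

definition complex_GL :: "nat \<Rightarrow> complex mat monoid" where
  "complex_GL n = units_of (ring_mat TYPE(complex) n ())"

definition complex_representation ::
    "('a, 'b) monoid_scheme \<Rightarrow> nat \<Rightarrow> ('a \<Rightarrow> complex mat) \<Rightarrow> bool" where
  "complex_representation G n \<rho> \<longleftrightarrow> \<rho> \<in> hom G (complex_GL n)"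

definition irreducible_representation ::
    "('a, 'b) monoid_scheme \<Rightarrow> nat \<Rightarrow> ('a \<Rightarrow> complex mat) \<Rightarrow> bool" where
  "irreducible_representation G n \<rho> \<longleftrightarrow>
     complex_representation G n \<rho> \<and> n > 0 \<and>
     (\<forall>W. subspace class_ring W (module_vec TYPE(complex) n) \<and>
          (\<forall>g\<in>carrier G. \<forall>w\<in>W. \<rho> g *\<^sub>v w \<in> W) \<longrightarrow>
          W = {0\<^sub>v n} \<or> W = carrier_vec n)"

definition mat_trace :: "complex mat \<Rightarrow> complex" where
  "mat_trace A = (\<Sum>i<dim_row A. A $$ (i, i))"

(* Characters are total functions here; only their values on carrier G are constrained. *)
definition irreducible_character ::
    "('a, 'b) monoid_scheme \<Rightarrow> ('a \<Rightarrow> complex) \<Rightarrow> bool" where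
  "irreducible_character G \<chi> \<longleftrightarrow>
     (\<exists>n \<rho>. irreducible_representation G n \<rho> \<and> (\<forall>g\<in>carrier G. \<chi> g = mat_trace (\<rho> g)))"

definition character_degree :: "('a, 'b) monoid_scheme \<Rightarrow> ('a \<Rightarrow> complex) \<Rightarrow> complex" where
  "character_degree G \<chi> = \<chi> \<one>\<^bsub>G\<^esub>"

end

theory Submission
  imports Defs "HOL-Algebra.Group_Action" "HOL-Algebra.Multiplicative_Group"
begin

text \<open>
  Write \<open>\<gamma>\<^sub>i\<close> for the lower central series and \<open>[x, g] = x g x\<inverse> g\<inverse>\<close>.

  Whenever \<open>\<gamma>\<^sub>i\<^sub>+\<^sub>1\<close> is central, the map \<open>(x, g) \<mapsto> [x, g]\<close> on \<open>\<gamma>\<^sub>i \<times> G\<close> is multiplicative in each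
  variable, so every such map is a homomorphism into an abelian group and kills \<open>G'\<close> in the second
  variable. Combined with the fact that a subgroup of index \<open>p\<close> leaves no room for intermediate
  subgroups, this bounds the first factors of the series: \<open>|\<gamma>\<^sub>2 : \<gamma>\<^sub>3| = p\<close>
  (\<open>card_lower_central_2_dvd_prime\<close>), and for \<open>c\<close> in \<open>\<gamma>\<^sub>2\<close> outside \<open>\<gamma>\<^sub>3\<close> the homomorphism
  \<open>g \<mapsto> [c, g]\<close> maps \<open>G / G'\<close> onto \<open>\<gamma>\<^sub>3 / \<gamma>\<^sub>4\<close>, so that \<open>|\<gamma>\<^sub>3 : \<gamma>\<^sub>4|\<close> divides \<open>p\<^sup>2\<close>
  (\<open>card_lower_central_3_dvd_prime_square\<close>). That \<open>\<gamma>\<^sub>2 \<noteq> \<gamma>\<^sub>3\<close> comes from the strict descent of the series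
  of a finite \<open>p\<close>-group (\<open>p_group_lower_central_stationary_imp_trivial\<close>), as \<open>|G| \<ge> p\<^sup>6\<close> makes \<open>\<gamma>\<^sub>2\<close>
  nontrivial. The stated equivalence is then arithmetic. Equality
  \<open>|\<gamma>\<^sub>3 : \<gamma>\<^sub>4| = p\<^sup>2\<close> makes that homomorphism injective on \<open>G / G'\<close>: no \<open>b\<close> outside \<open>G'\<close> centralizes
  \<open>\<gamma>\<^sub>2\<close> modulo \<open>\<gamma>\<^sub>4\<close>.

  For the character, pass to \<open>G / \<gamma>\<^sub>5\<close>. There \<open>\<gamma>\<^sub>4\<close> is central; it is nontrivial because
  \<open>|G : \<gamma>\<^sub>4| = p\<^sup>5 < |G|\<close> and the series descends strictly. Moreover \<open>A = G'\<close> is abelian of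
  index \<open>p\<^sup>2\<close>. It suffices to find a linear character \<open>\<mu>\<close> of \<open>A\<close> that no element outside \<open>A\<close> fixes
  under conjugation, because inducing such a \<open>\<mu>\<close> gives an irreducible representation of degree
  \<open>|G : A| = p\<^sup>2\<close>. Start with a \<open>\<mu>\<^sub>0\<close> that is nontrivial on some \<open>[g, x]\<close> with \<open>x \<in> \<gamma>\<^sub>3\<close>. The stabilizer \<open>K\<close>
  of \<open>\<mu>\<^sub>0\<close> restricted to \<open>\<gamma>\<^sub>3\<close> contains \<open>A\<close>, is not \<open>G\<close>, and depends only on the values of \<open>\<mu>\<^sub>0\<close> on
  \<open>\<gamma>\<^sub>4\<close>. If \<open>K = A\<close>, then \<open>\<mu>\<^sub>0\<close> is as desired. Otherwise \<open>|K : A| = p\<close>; choose \<open>b\<close> in \<open>K\<close> outside \<open>A\<close> and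
  \<open>c \<in> A\<close> with \<open>[b, c] \<notin> \<gamma>\<^sub>4\<close>, and extend \<open>\<mu>\<^sub>0\<close> from \<open>\<gamma>\<^sub>4\<close> to \<open>A\<close> afresh so that it is nontrivial on
  \<open>[b, c]\<close>. The new stabilizer lies in \<open>K\<close> and misses \<open>b\<close>, hence equals \<open>A\<close>
  (\<open>exists_character_with_trivial_stabilizer\<close>).
\<close>

section \<open>Counting subgroups\<close>

text \<open>All nonempty fibres of a homomorphism on a subgroup are translates of its kernel.\<close>
lemma (in group_hom) card_image_mult_kernel:
  assumes fin: "finite (carrier G)" and S: "subgroup S G"
  shows "card (h ` S) * card {x \<in> S. h x = \<one>\<^bsub>H\<^esub>} = card S"
proof -
  interpret S: subgroup S G by fact
  have finS: "finite S" using fin S.subset finite_subset by blast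
  have fib: "card {x \<in> S. h x = y} = card {x \<in> S. h x = \<one>\<^bsub>H\<^esub>}" if y: "y \<in> h ` S" for y
  proof -
    obtain s where s: "s \<in> S" "y = h s" using y by blast
    have "bij_betw (\<lambda>x. s \<otimes> x) {x \<in> S. h x = \<one>\<^bsub>H\<^esub>} {x \<in> S. h x = y}"
    proof (rule bij_betw_byWitness[where f' = "\<lambda>x. inv s \<otimes> x"])
      show "\<forall>a\<in>{x \<in> S. h x = \<one>\<^bsub>H\<^esub>}. inv s \<otimes> (s \<otimes> a) = a"
        using s by (simp add: G.m_assoc[symmetric])
      show "\<forall>a\<in>{x \<in> S. h x = y}. s \<otimes> (inv s \<otimes> a) = a"
        using s by (simp add: G.m_assoc[symmetric])
      show "(\<otimes>) s ` {x \<in> S. h x = \<one>\<^bsub>H\<^esub>} \<subseteq> {x \<in> S. h x = y}"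
        using s by auto
      show "(\<otimes>) (inv s) ` {x \<in> S. h x = y} \<subseteq> {x \<in> S. h x = \<one>\<^bsub>H\<^esub>}"
        using s by auto
    qed
    then show ?thesis by (rule bij_betw_same_card[symmetric])
  qed
  have "card S = (\<Sum>y\<in>h ` S. card {x \<in> S. h x = y})"
    using sum.image_gen[OF finS, of "\<lambda>_. 1::nat" h] by simp
  also have "\<dots> = card (h ` S) * card {x \<in> S. h x = \<one>\<^bsub>H\<^esub>}"
    using fib by simp
  finally show ?thesis by simp
qed

lemma (in group) card_subgroup_dvd:
  assumes "subgroup A G" "subgroup S G" "A \<subseteq> S"
  shows "card A dvd card S"
proof -
  interpret S: group "G\<lparr>carrier := S\<rparr>" using assms(2) by (rule subgroup_imp_group)
  have "subgroup A (G\<lparr>carrier := S\<rparr>)" using subgroup_incl[OF assms] .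
  from S.lagrange[OF this] have "card (rcosets\<^bsub>G\<lparr>carrier := S\<rparr>\<^esub> A) * card A = card S" by (simp add: Coset.order_def)
  thus ?thesis by (metis dvd_triv_right)
qed

text \<open>This replaces most arguments with generators: to see that a property holds on all of \<open>M\<close>, it is enough
  that it defines a subgroup of \<open>M\<close> containing \<open>A\<close> and at least one further element.\<close>
lemma (in group) subgroup_between_prime_index:
  assumes fin: "finite (carrier G)" and p: "prime p"
    and A: "subgroup A G" and S: "subgroup S G" and M: "subgroup M G"
    and sub: "A \<subseteq> S" "S \<subseteq> M" and card: "card M = p * card A"
  shows "S = A \<or> S = M"
proof -
  have finM: "finite M" using fin subgroup.subset[OF M] finite_subset by blast
  have pos: "card A > 0" using subgroup.finite_imp_card_positive[OF A fin] .
  obtain k where k: "card S = card A * k" using card_subgroup_dvd[OF A S sub(1)] by (auto simp: dvd_def)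
  have "card A * k dvd card A * p" using card_subgroup_dvd[OF S M sub(2)] k card by (simp add: mult.commute)
  hence "k dvd p" using pos by simp
  hence "k = 1 \<or> k = p" using p by (auto simp: prime_nat_iff)
  thus ?thesis
  proof
    assume "k = 1" thus ?thesis using card_subset_eq[OF finite_subset[OF sub(2) finM] sub(1)] k by simp
  next
    assume "k = p" thus ?thesis using card_subset_eq[OF finM sub(2)] k card by (simp add: mult.commute)
  qed
qed

lemma (in group) subgroup_between_prime_square_index:
  assumes fin: "finite (carrier G)" and p: "prime p"
    and A: "subgroup A G" and S: "subgroup S G" and sub: "A \<subseteq> S" and ne: "S \<noteq> A" "S \<noteq> carrier G"
    and card: "Coset.order G = p ^ 2 * card A"
  shows "card S = p * card A"
proof -
  have finS: "finite S" using fin subgroup.subset[OF S] finite_subset by blast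
  have pos: "card A > 0" using subgroup.finite_imp_card_positive[OF A fin] .
  obtain k where k: "card S = card A * k" using card_subgroup_dvd[OF A S sub] by (auto simp: dvd_def)
  have "card S dvd Coset.order G"
    using card_subgroup_dvd[OF S subgroup_self subgroup.subset[OF S]] by (simp add: Coset.order_def)
  hence "card A * k dvd card A * p ^ 2" using k card by (simp add: mult.commute)
  hence "k dvd p ^ 2" using pos by simp
  then obtain i where i: "i \<le> 2" "k = p ^ i" using p by (auto simp: divides_primepow_nat)
  have "i \<noteq> 0" using card_subset_eq[OF finS sub] k i ne by auto
  moreover have "i \<noteq> 2"
    using card_subset_eq[OF fin subgroup.subset[OF S]] k i ne card by (auto simp: Coset.order_def mult.commute)
  ultimately have "i = 1" using i by linarith
  thus ?thesis using k i by (simp add: mult.commute)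
qed

section \<open>Commutators and the lower central series\<close>

definition commutator :: "('a, 'b) monoid_scheme \<Rightarrow> 'a \<Rightarrow> 'a \<Rightarrow> 'a" where
  "commutator G x y = x \<otimes>\<^bsub>G\<^esub> y \<otimes>\<^bsub>G\<^esub> inv\<^bsub>G\<^esub> x \<otimes>\<^bsub>G\<^esub> inv\<^bsub>G\<^esub> y"

context group begin

lemma inv_mult_cancel [simp]: "x \<in> carrier G \<Longrightarrow> y \<in> carrier G \<Longrightarrow> inv x \<otimes> (x \<otimes> y) = y"
  by (simp add: m_assoc[symmetric])
lemma mult_inv_cancel [simp]: "x \<in> carrier G \<Longrightarrow> y \<in> carrier G \<Longrightarrow> x \<otimes> (inv x \<otimes> y) = y"
  by (simp add: m_assoc[symmetric])

lemma commutator_closed [simp]: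
  "x \<in> carrier G \<Longrightarrow> y \<in> carrier G \<Longrightarrow> commutator G x y \<in> carrier G"
  by (simp add: commutator_def)

text \<open>Hence a linear character of a subgroup containing \<open>[x, g]\<close> and \<open>g\<close> takes the same value at \<open>g\<close> and at its
  conjugate by \<open>x\<close> exactly if it is trivial on \<open>[x, g]\<close>.\<close>
lemma conj_eq_commutator_mult:
  "x \<in> carrier G \<Longrightarrow> g \<in> carrier G \<Longrightarrow> x \<otimes> g \<otimes> inv x = commutator G x g \<otimes> g"
  by (simp add: commutator_def m_assoc)

lemma commutator_eq_one_iff:
  assumes "x \<in> carrier G" "g \<in> carrier G"
  shows "commutator G x g = \<one> \<longleftrightarrow> x \<otimes> g = g \<otimes> x"
proof
  assume "commutator G x g = \<one>"
  hence "commutator G x g \<otimes> (g \<otimes> x) = g \<otimes> x" using assms by simp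
  thus "x \<otimes> g = g \<otimes> x" using assms by (simp add: commutator_def m_assoc)
next
  assume "x \<otimes> g = g \<otimes> x"
  thus "commutator G x g = \<one>" using assms by (simp add: commutator_def m_assoc)
qed

lemma commutator_inverse:
  "x \<in> carrier G \<Longrightarrow> g \<in> carrier G \<Longrightarrow> inv (commutator G x g) = commutator G g x"
  by (simp add: commutator_def inv_mult_group m_assoc)

lemma commutator_mult_right:
  "\<lbrakk>x \<in> carrier G; g \<in> carrier G; h \<in> carrier G\<rbrakk> \<Longrightarrow>
     commutator G x (g \<otimes> h) = commutator G x g \<otimes> (g \<otimes> commutator G x h \<otimes> inv g)"
  by (simp add: commutator_def inv_mult_group m_assoc)

lemma commutator_mult_left:
  "\<lbrakk>x \<in> carrier G; y \<in> carrier G; g \<in> carrier G\<rbrakk> \<Longrightarrow>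
     commutator G (x \<otimes> y) g = (x \<otimes> commutator G y g \<otimes> inv x) \<otimes> commutator G x g"
  by (simp add: commutator_def inv_mult_group m_assoc)

lemma conj_commutator:
  "\<lbrakk>x \<in> carrier G; y \<in> carrier G; g \<in> carrier G\<rbrakk> \<Longrightarrow>
     g \<otimes> commutator G x y \<otimes> inv g = commutator G (g \<otimes> x \<otimes> inv g) (g \<otimes> y \<otimes> inv g)"
  by (simp add: commutator_def inv_mult_group m_assoc)

lemma conj_of_commuting:
  "\<lbrakk>z \<in> carrier G; g \<in> carrier G; z \<otimes> g = g \<otimes> z\<rbrakk> \<Longrightarrow> g \<otimes> z \<otimes> inv g = z"
  by (metis inv_closed m_assoc r_inv r_one)

text \<open>The source of all linearity below: the conjugations in the general expansion of a commutator of products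
  disappear when the commutator being conjugated is central.\<close>
lemma commutator_mult_right_central:
  assumes "x \<in> carrier G" "g \<in> carrier G" "h \<in> carrier G"
    "commutator G x h \<otimes> g = g \<otimes> commutator G x h"
  shows "commutator G x (g \<otimes> h) = commutator G x g \<otimes> commutator G x h"
  using assms by (simp add: commutator_mult_right conj_of_commuting)

lemma commutator_mult_left_central:
  assumes "x \<in> carrier G" "y \<in> carrier G" "g \<in> carrier G"
    "commutator G y g \<otimes> x = x \<otimes> commutator G y g"
  shows "commutator G (x \<otimes> y) g = commutator G y g \<otimes> commutator G x g"
  using assms by (simp add: commutator_mult_left conj_of_commuting)

lemma commutator_subgroup_alt:
  "commutator_subgroup G H K = generate G {commutator G h k | h k. h \<in> H \<and> k \<in> K}"
proof -
  have "(\<Union>h\<in>H. \<Union>k\<in>K. {h \<otimes> k \<otimes> inv h \<otimes> inv k}) = {commutator G h k | h k. h \<in> H \<and> k \<in> K}"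
    by (auto simp: commutator_def)
  thus ?thesis by (simp add: commutator_subgroup_def)
qed

lemma commutator_mem_commutator_subgroup:
  "h \<in> H \<Longrightarrow> k \<in> K \<Longrightarrow> commutator G h k \<in> commutator_subgroup G H K"
  unfolding commutator_subgroup_alt by (rule generate.incl) auto

lemma commutator_subgroup_least:
  assumes "subgroup S G" "\<And>h k. h \<in> H \<Longrightarrow> k \<in> K \<Longrightarrow> commutator G h k \<in> S"
  shows "commutator_subgroup G H K \<subseteq> S"
  unfolding commutator_subgroup_alt using assms by (intro generate_subgroup_incl) auto

lemma commutator_subgroup_normal:
  assumes "H \<lhd> G" shows "commutator_subgroup G H (carrier G) \<lhd> G"
proof -
  interpret H: normal H G by fact
  show ?thesis unfolding commutator_subgroup_alt
  proof (rule normal_generateI)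
    show "{commutator G h k |h k. h \<in> H \<and> k \<in> carrier G} \<subseteq> carrier G" by auto
    fix x g assume "x \<in> {commutator G h k |h k. h \<in> H \<and> k \<in> carrier G}" and g: "g \<in> carrier G"
    then obtain h k where hk: "h \<in> H" "k \<in> carrier G" "x = commutator G h k" by blast
    have "g \<otimes> x \<otimes> inv g = commutator G (g \<otimes> h \<otimes> inv g) (g \<otimes> k \<otimes> inv g)"
      using hk g by (simp add: conj_commutator)
    moreover have "g \<otimes> h \<otimes> inv g \<in> H" using hk g by (simp add: H.inv_op_closed2)
    moreover have "g \<otimes> k \<otimes> inv g \<in> carrier G" using hk g by simp
    ultimately show "g \<otimes> x \<otimes> inv g \<in> {commutator G h k |h k. h \<in> H \<and> k \<in> carrier G}" by blast
  qed
qed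

lemma commutator_mem_normal:
  assumes "H \<lhd> G" "h \<in> H" "g \<in> carrier G" shows "commutator G h g \<in> H"
proof -
  interpret H: normal H G by fact
  have "g \<otimes> inv h \<otimes> inv g \<in> H" using assms by (simp add: H.inv_op_closed2)
  hence "h \<otimes> (g \<otimes> inv h \<otimes> inv g) \<in> H" using assms by simp
  thus ?thesis using assms by (simp add: commutator_def m_assoc)
qed

lemma lower_central_normal: "lower_central G i \<lhd> G"
proof -
  have "((\<lambda>H. commutator_subgroup G H (carrier G)) ^^ n) (carrier G) \<lhd> G" for n
    by (induction n) (auto simp: normal_self commutator_subgroup_normal)
  thus ?thesis by (simp add: lower_central_def)
qed

lemma lower_central_subgroup: "subgroup (lower_central G i) G"
  using lower_central_normal normal_imp_subgroup by blast

lemma lower_central_closed: "x \<in> lower_central G i \<Longrightarrow> x \<in> carrier G"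
  by (rule subgroup.mem_carrier[OF lower_central_subgroup])

lemma commutator_mem_lower_central:
  "\<lbrakk>x \<in> lower_central G i; g \<in> carrier G; i \<ge> 1\<rbrakk> \<Longrightarrow> commutator G x g \<in> lower_central G (Suc i)"
  by (simp add: lower_central_Suc commutator_mem_commutator_subgroup)

lemma commutator_mem_lower_central':
  assumes "x \<in> lower_central G i" "g \<in> carrier G" "i \<ge> 1"
  shows "commutator G g x \<in> lower_central G (Suc i)"
  using subgroup.m_inv_closed[OF lower_central_subgroup commutator_mem_lower_central[OF assms]]
  by (simp add: commutator_inverse lower_central_closed[OF assms(1)] assms(2))

lemma lower_central_Suc_least:
  "\<lbrakk>i \<ge> 1; subgroup S G; \<And>x g. x \<in> lower_central G i \<Longrightarrow> g \<in> carrier G \<Longrightarrow> commutator G x g \<in> S\<rbrakk>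
     \<Longrightarrow> lower_central G (Suc i) \<subseteq> S"
  by (simp add: lower_central_Suc commutator_subgroup_least)

lemma lower_central_Suc_subset: "lower_central G (Suc i) \<subseteq> lower_central G i"
proof (cases "i = 0")
  case True thus ?thesis by (simp add: lower_central_def)
next
  case False
  thus ?thesis using commutator_mem_normal[OF lower_central_normal]
    by (intro lower_central_Suc_least lower_central_subgroup) auto
qed

lemma commutator_mem_lower_central_2:
  "\<lbrakk>x \<in> carrier G; g \<in> carrier G\<rbrakk> \<Longrightarrow> commutator G x g \<in> lower_central G 2"
  using commutator_mem_lower_central[of x 1 g] lower_central_1[of G, unfolded One_nat_def] by (simp add: numeral_2_eq_2)

lemma lower_central_2_least:
  "\<lbrakk>subgroup S G; \<And>x g. x \<in> carrier G \<Longrightarrow> g \<in> carrier G \<Longrightarrow> commutator G x g \<in> S\<rbrakk>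
     \<Longrightarrow> lower_central G 2 \<subseteq> S"
  using lower_central_Suc_least[of 1 S] lower_central_1[of G, unfolded One_nat_def] by (simp add: numeral_2_eq_2)

lemma lower_central_trivial_next_commute:
  assumes "lower_central G (Suc i) = {\<one>}" "i \<ge> 1" "x \<in> lower_central G i" "g \<in> carrier G"
  shows "x \<otimes> g = g \<otimes> x"
  using commutator_mem_lower_central[OF assms(3,4,2)] assms(1)
    commutator_eq_one_iff[OF lower_central_closed[OF assms(3)] assms(4)] by simp

lemma commutator_hom_right:
  assumes "x \<in> carrier G"
    "\<And>g h. g \<in> carrier G \<Longrightarrow> h \<in> carrier G \<Longrightarrow> commutator G x g \<otimes> h = h \<otimes> commutator G x g"
  shows "group_hom G G (\<lambda>g. commutator G x g)"
proof -
  have "(\<lambda>g. commutator G x g) \<in> hom G G"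
  proof (rule homI)
    fix g h assume "g \<in> carrier G" "h \<in> carrier G"
    thus "commutator G x (g \<otimes> h) = commutator G x g \<otimes> commutator G x h"
      by (intro commutator_mult_right_central assms)
  qed (use assms(1) in simp)
  thus ?thesis by unfold_locales
qed

lemma commutator_hom_left:
  assumes "subgroup S G" "g \<in> carrier G"
    "\<And>x h. x \<in> S \<Longrightarrow> h \<in> carrier G \<Longrightarrow> commutator G x g \<otimes> h = h \<otimes> commutator G x g"
  shows "group_hom (G\<lparr>carrier := S\<rparr>) G (\<lambda>x. commutator G x g)"
proof -
  interpret S: subgroup S G by fact
  interpret GS: group "G\<lparr>carrier := S\<rparr>" using assms(1) by (rule subgroup_imp_group)
  have "(\<lambda>x. commutator G x g) \<in> hom (G\<lparr>carrier := S\<rparr>) G"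
  proof (rule homI)
    fix x y assume "x \<in> carrier (G\<lparr>carrier := S\<rparr>)" "y \<in> carrier (G\<lparr>carrier := S\<rparr>)"
    hence xy: "x \<in> S" "y \<in> S" by auto
    have "commutator G (x \<otimes> y) g = commutator G y g \<otimes> commutator G x g"
      using xy assms(2) by (intro commutator_mult_left_central assms(3)) auto
    also have "\<dots> = commutator G x g \<otimes> commutator G y g"
      using xy assms(2) by (intro assms(3)) auto
    finally show "commutator G (x \<otimes>\<^bsub>G\<lparr>carrier := S\<rparr>\<^esub> y) g = commutator G x g \<otimes> commutator G y g"
      by simp
  qed (use assms(2) in auto)
  thus ?thesis by unfold_locales
qed

text \<open>The centralizer is taken inside a subgroup \<open>S\<close>, so that it can be placed between a known subgroup and \<open>S\<close>.\<close>
definition centralizer_in :: "'a set \<Rightarrow> 'a \<Rightarrow> 'a set" where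
  "centralizer_in S a = {x \<in> S. x \<otimes> a = a \<otimes> x}"

lemma centralizer_in_subgroup:
  assumes "subgroup S G" "a \<in> carrier G"
  shows "subgroup (centralizer_in S a) G"
proof -
  interpret S: subgroup S G by fact
  show ?thesis
  proof (rule subgroupI)
    show "centralizer_in S a \<subseteq> carrier G" using S.subset by (auto simp: centralizer_in_def)
    have "\<one> \<in> centralizer_in S a" using assms by (auto simp: centralizer_in_def)
    thus "centralizer_in S a \<noteq> {}" by blast
    fix x assume x: "x \<in> centralizer_in S a"
    hence xc: "x \<in> S" "x \<in> carrier G" and xa: "x \<otimes> a = a \<otimes> x" by (auto simp: centralizer_in_def)
    have "inv x \<otimes> a = inv x \<otimes> (a \<otimes> x) \<otimes> inv x" using xc assms by (simp add: m_assoc)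
    also have "\<dots> = inv x \<otimes> (x \<otimes> a) \<otimes> inv x" by (simp only: xa)
    also have "\<dots> = a \<otimes> inv x" using xc assms by (simp add: m_assoc)
    finally show "inv x \<in> centralizer_in S a" using xc by (simp add: centralizer_in_def)
    fix y assume "y \<in> centralizer_in S a"
    hence yc: "y \<in> S" "y \<in> carrier G" and ya: "y \<otimes> a = a \<otimes> y" by (auto simp: centralizer_in_def)
    have "x \<otimes> y \<otimes> a = x \<otimes> (y \<otimes> a)" using xc yc assms by (simp add: m_assoc)
    also have "\<dots> = x \<otimes> a \<otimes> y" using xc yc assms by (simp add: m_assoc ya)
    also have "\<dots> = a \<otimes> (x \<otimes> y)" using xc yc assms by (simp add: m_assoc xa)
    finally show "x \<otimes> y \<in> centralizer_in S a" using xc yc by (simp add: centralizer_in_def)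
  qed
qed

end

lemma (in group_hom) subgroup_preimage:
  assumes "subgroup J H" shows "subgroup {x \<in> carrier G. h x \<in> J} G"
proof -
  interpret J: subgroup J H by fact
  show ?thesis by (rule G.subgroupI) (auto intro: exI[of _ "\<one>"])
qed

lemma (in group_hom) image_commutator:
  "\<lbrakk>x \<in> carrier G; y \<in> carrier G\<rbrakk> \<Longrightarrow> h (commutator G x y) = commutator H (h x) (h y)"
  by (simp add: commutator_def)

lemma (in group_hom) image_commutator_subgroup:
  assumes "K \<subseteq> carrier G" "h ` carrier G = carrier H"
  shows "h ` commutator_subgroup G K (carrier G) = commutator_subgroup H (h ` K) (carrier H)"
proof -
  have "{commutator H x y |x y. x \<in> h ` K \<and> y \<in> carrier H} = h ` {commutator G x y |x y. x \<in> K \<and> y \<in> carrier G}"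
    (is "?L = ?R")
  proof
    have eq: "commutator H (h x) (h y) = h (commutator G x y)" if "x \<in> K" "y \<in> carrier G" for x y
      using that assms(1) by (auto simp: commutator_def subset_iff)
    show "?R \<subseteq> ?L"
    proof
      fix z assume "z \<in> ?R"
      then obtain x y where "x \<in> K" "y \<in> carrier G" "z = h (commutator G x y)" by blast
      thus "z \<in> ?L" using eq[of x y] by (intro CollectI exI[of _ "h x"] exI[of _ "h y"]) simp
    qed
    show "?L \<subseteq> ?R"
    proof
      fix z assume "z \<in> ?L"
      then obtain x y where xy: "x \<in> K" "y \<in> carrier H" "z = commutator H (h x) y" by blast
      then obtain y' where "y' \<in> carrier G" "y = h y'" using assms(2) by blast
      thus "z \<in> ?R" using eq[of x y'] xy by blast
    qed
  qed
  moreover have "{commutator G x y |x y. x \<in> K \<and> y \<in> carrier G} \<subseteq> carrier G" using assms(1) by auto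
  ultimately show ?thesis
    unfolding G.commutator_subgroup_alt H.commutator_subgroup_alt by (simp add: generate_img)
qed

lemma (in group_hom) image_lower_central:
  assumes "h ` carrier G = carrier H"
  shows "h ` lower_central G i = lower_central H i"
proof -
  have "h ` ((\<lambda>K. commutator_subgroup G K (carrier G)) ^^ n) (carrier G)
      = ((\<lambda>K. commutator_subgroup H K (carrier H)) ^^ n) (carrier H)
      \<and> ((\<lambda>K. commutator_subgroup G K (carrier G)) ^^ n) (carrier G) \<subseteq> carrier G" for n
  proof (induction n)
    case 0 thus ?case using assms by simp
  next
    case (Suc n)
    let ?K = "((\<lambda>K. commutator_subgroup G K (carrier G)) ^^ n) (carrier G)"
    have "commutator_subgroup G ?K (carrier G) \<subseteq> carrier G"
      using Suc by (intro G.commutator_subgroup_least G.subgroup_self) (auto simp: subset_iff)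
    thus ?case using Suc image_commutator_subgroup[OF _ assms, of ?K] by simp
  qed
  thus ?thesis by (simp add: lower_central_def)
qed

section \<open>Strict descent of the lower central series in finite p-groups\<close>

text \<open>The class equation for the conjugation action on a normal subgroup \<open>N\<close>: an orbit has \<open>p\<close>-power size, and
  size \<open>1\<close> only for central elements. If \<open>\<one>\<close> were the only central element of \<open>N\<close>, then \<open>|N| - 1\<close> would be
  divisible by \<open>p\<close>, as \<open>|N|\<close> is.\<close>
lemma (in group) normal_subgroup_of_p_group_meets_center:
  assumes fin: "finite (carrier G)" and p: "prime p" and ord: "Coset.order G = p ^ n"
    and N: "N \<lhd> G" "N \<noteq> {\<one>}"
  shows "\<exists>z\<in>N. z \<noteq> \<one> \<and> (\<forall>g\<in>carrier G. g \<otimes> z \<otimes> inv g = z)"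
proof (rule ccontr)
  assume no: "\<not> ?thesis"
  interpret N: normal N G by fact
  let ?\<phi> = "\<lambda>g. \<lambda>h \<in> carrier G. g \<otimes> h \<otimes> inv g"
  interpret act: group_action G "carrier G" ?\<phi> by (rule action_by_conjugation)
  define orb where "orb = orbit G ?\<phi>"
  have orb: "orb x = {g \<otimes> x \<otimes> inv g | g. g \<in> carrier G}" if "x \<in> carrier G" for x
    using that by (auto simp: orb_def orbit_def)
  have finN: "finite N" using fin N.subset finite_subset by blast
  have self: "x \<in> orb x" if "x \<in> carrier G" for x
    using orb[OF that] that by (auto intro!: exI[of _ \<one>])
  have sub: "orb x \<subseteq> N - {\<one>}" if x: "x \<in> N - {\<one>}" for x
  proof -
    have "x = \<one>" if g: "g \<in> carrier G" "g \<otimes> x \<otimes> inv g = \<one>" for g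
    proof -
      have "x = inv g \<otimes> (g \<otimes> x \<otimes> inv g) \<otimes> g" using x g(1) by (simp add: m_assoc)
      thus ?thesis using g by simp
    qed
    thus ?thesis using x orb[of x] by (auto simp: N.inv_op_closed2)
  qed
  have dvd: "p dvd card (orb x)" if x: "x \<in> N - {\<one>}" for x
  proof -
    have xc: "x \<in> carrier G" using x by auto
    have "card (orb x) * card (stabilizer G ?\<phi> x) = p ^ n"
      unfolding orb_def using act.orbit_stabilizer_theorem[OF xc] ord by simp
    hence "card (orb x) dvd p ^ n" by (metis dvd_triv_left)
    then obtain i where i: "card (orb x) = p ^ i" using p by (auto simp: divides_primepow_nat)
    have "i \<noteq> 0"
    proof
      assume "i = 0"
      hence "card (orb x) = 1" using i by simp
      then obtain y where "orb x = {y}" by (auto simp: card_1_singleton_iff)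
      hence "orb x = {x}" using self[OF xc] by auto
      hence "\<forall>g\<in>carrier G. g \<otimes> x \<otimes> inv g = x" using orb[OF xc] by auto
      thus False using no x by auto
    qed
    thus ?thesis using i by (cases i) auto
  qed
  have eq: "N - {\<one>} = \<Union> (orb ` (N - {\<one>}))" 
  proof
    show "N - {\<one>} \<subseteq> \<Union> (orb ` (N - {\<one>}))" using self N.mem_carrier by blast
    show "\<Union> (orb ` (N - {\<one>})) \<subseteq> N - {\<one>}" using sub by blast
  qed
  have "card (\<Union> (orb ` (N - {\<one>}))) = sum card (orb ` (N - {\<one>}))"
  proof (rule card_Union_disjoint)
    show "pairwise disjnt (orb ` (N - {\<one>}))"
    proof (rule pairwiseI)
      fix S T assume ST: "S \<in> orb ` (N - {\<one>})" "T \<in> orb ` (N - {\<one>})" "S \<noteq> T"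
      have "orb x \<in> orbits G (carrier G) ?\<phi>" if "x \<in> N - {\<one>}" for x
      proof -
        have "x \<in> carrier G" using that by simp
        thus ?thesis unfolding orb_def orbits_def by blast
      qed
      hence "S \<in> orbits G (carrier G) ?\<phi>" "T \<in> orbits G (carrier G) ?\<phi>"
        using ST(1,2) by blast+
      thus "disjnt S T" using act.disjoint_union[of S T] ST(3) unfolding disjnt_def by blast
    qed
    have "finite (orb x)" if "x \<in> N - {\<one>}" for x
      by (rule finite_subset[OF sub[OF that]]) (simp add: finN)
    thus "finite A" if "A \<in> orb ` (N - {\<one>})" for A
      using that by (elim imageE) simp
  qed
  moreover have "p dvd sum card (orb ` (N - {\<one>}))" using dvd by (intro dvd_sum) auto
  ultimately have "p dvd card (N - {\<one>})" using eq by simp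
  moreover have "card N = Suc (card (N - {\<one>}))" using card.remove[OF finN N.one_closed] .
  moreover have "p dvd card N"
  proof -
    have "card N dvd p ^ n" using card_subgroup_dvd[OF N.is_subgroup subgroup_self N.subset] ord
      by (simp add: Coset.order_def)
    then obtain i where i: "card N = p ^ i" using p by (auto simp: divides_primepow_nat)
    have "i \<noteq> 0"
    proof
      assume "i = 0"
      hence "card N = 1" using i by simp
      thus False using N(2) N.one_closed by (metis card_1_singletonE singletonD)
    qed
    thus ?thesis using i by (cases i) auto
  qed
  ultimately have "p dvd Suc (card (N - {\<one>}))" "p dvd card (N - {\<one>})" by metis+
  hence "p dvd 1" using dvd_add_left_iff[of p "card (N - {\<one>})" 1] by (simp only: plus_1_eq_Suc)
  thus False using p by auto
qed

lemma (in normal) coset_group_hom: "group_hom G (G Mod H) (\<lambda>a. H #> a)"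
  using r_coset_hom_Mod factorgroup_is_group is_group
  by (simp add: group_hom_def group_hom_axioms_def)

lemma (in normal) coset_eq_one_iff: "x \<in> carrier G \<Longrightarrow> H #> x = H \<longleftrightarrow> x \<in> H"
  using is_subgroup coset_join1 coset_join2 subset by metis

text \<open>Nilpotency in the only form that is used: \<open>[N, G] = N\<close> forces \<open>N\<close> to be trivial. Take \<open>M\<close> maximal among the
  normal subgroups of \<open>G\<close> properly contained in \<open>N\<close>. The elements of \<open>N\<close> that are central modulo \<open>M\<close> form a
  normal subgroup, which is larger than \<open>M\<close> since \<open>N / M\<close> meets the center of \<open>G / M\<close>. So it is \<open>N\<close>, and
  \<open>[N, G]\<close> lies in \<open>M\<close>.\<close>
lemma (in group) p_group_commutator_subgroup_fixed_imp_trivial: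
  assumes fin: "finite (carrier G)" and p: "prime p" and ord: "Coset.order G = p ^ n"
    and N: "N \<lhd> G" and eq: "commutator_subgroup G N (carrier G) = N"
  shows "N = {\<one>}"
proof (rule ccontr)
  assume ne: "N \<noteq> {\<one>}"
  interpret N: normal N G by fact
  let ?C = "{M. M \<lhd> G \<and> M \<subset> N}"
  have "finite ?C" using fin by (rule finite_subset[rotated, OF finite_Pow_iff[THEN iffD2]]) (use N.subset in auto)
  moreover have "?C \<noteq> {}" using ne one_is_normal N.one_closed by blast
  ultimately have "\<exists>M\<in>?C. \<forall>M'\<in>?C. M \<subseteq> M' \<longrightarrow> M = M'" by (rule finite_has_maximal)
  then obtain M where M: "M \<lhd> G" "M \<subset> N" and max: "\<And>M'. M' \<lhd> G \<Longrightarrow> M' \<subset> N \<Longrightarrow> M \<subseteq> M' \<Longrightarrow> M = M'"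
    by auto
  interpret M: normal M G by fact
  interpret q: group_hom G "G Mod M" "\<lambda>a. M #> a" by (rule M.coset_group_hom)
  have surj: "(\<lambda>a. M #> a) ` carrier G = carrier (G Mod M)" by (simp add: carrier_FactGroup)
  \<comment> \<open>The part of \<open>N\<close> that becomes central modulo \<open>M\<close>.\<close>
  define F where "F = {x \<in> N. \<forall>g\<in>carrier G. commutator G x g \<in> M}"
  have conjM: "g \<otimes> x \<otimes> inv g \<in> M" if "x \<in> M" "g \<in> carrier G" for g x using that by (simp add: M.inv_op_closed2)
  have "F \<lhd> G"
  proof (rule normal_invI)
    show "subgroup F G"
    proof (rule subgroupI)
      show "F \<subseteq> carrier G" using N.subset by (auto simp: F_def)
      have "\<one> \<in> F" by (auto simp: F_def commutator_def)
      thus "F \<noteq> {}" by blast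
      fix x assume x: "x \<in> F"
      have xN: "x \<in> N" "x \<in> carrier G" using x by (auto simp: F_def)
      have "commutator G (inv x) g \<in> M" if g: "g \<in> carrier G" for g
      proof -
        have "commutator G (inv x) g = inv x \<otimes> inv (commutator G x g) \<otimes> inv (inv x)"
          using xN g by (simp add: commutator_def inv_mult_group m_assoc)
        moreover have "inv (commutator G x g) \<in> M" using x g by (simp add: F_def)
        ultimately show ?thesis using conjM[of "inv (commutator G x g)" "inv x"] xN by simp
      qed
      thus "inv x \<in> F" using xN by (simp add: F_def)
      fix y assume y: "y \<in> F"
      have yN: "y \<in> N" "y \<in> carrier G" using y by (auto simp: F_def)
      have "commutator G (x \<otimes> y) g \<in> M" if g: "g \<in> carrier G" for g
        unfolding commutator_mult_left[OF xN(2) yN(2) g]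
        using x y g xN by (intro M.m_closed conjM) (auto simp: F_def)
      thus "x \<otimes> y \<in> F" using xN yN by (simp add: F_def)
    qed
    fix g x assume g: "g \<in> carrier G" and x: "x \<in> F"
    have xN: "x \<in> N" "x \<in> carrier G" using x by (auto simp: F_def)
    have "commutator G (g \<otimes> x \<otimes> inv g) k \<in> M" if k: "k \<in> carrier G" for k
    proof -
      have "commutator G (g \<otimes> x \<otimes> inv g) k = g \<otimes> commutator G x (inv g \<otimes> k \<otimes> g) \<otimes> inv g"
        using xN g k by (simp add: commutator_def inv_mult_group m_assoc)
      thus ?thesis using x g k conjM by (simp add: F_def)
    qed
    thus "g \<otimes> x \<otimes> inv g \<in> F" using xN g by (simp add: F_def N.inv_op_closed2)
  qed
  moreover have "M \<subseteq> F" using M commutator_mem_normal[OF M(1)] by (auto simp: F_def)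
  moreover have "F \<noteq> M"
  proof -
    have finq: "finite (carrier (G Mod M))" using fin surj by (metis finite_imageI)
    have carrier_Mod: "Coset.order (G Mod M) = card (rcosets M)" by (simp add: Coset.order_def FactGroup_def)
    have "Coset.order (G Mod M) dvd p ^ n"
      using lagrange[OF M.is_subgroup] ord by (metis dvd_triv_left carrier_Mod)
    then obtain k where k: "Coset.order (G Mod M) = p ^ k" using p by (auto simp: divides_primepow_nat)
    have Nq: "(\<lambda>a. M #> a) ` N \<lhd> G Mod M"
      using N.surj_hom_normal_subgroup[OF q.group_hom_axioms surj] .
    obtain x0 where x0: "x0 \<in> N" "x0 \<notin> M" using M(2) by blast
    have "(\<lambda>a. M #> a) ` N \<noteq> {\<one>\<^bsub>G Mod M\<^esub>}"
      using x0 M.coset_eq_one_iff[of x0] by auto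
    from q.H.normal_subgroup_of_p_group_meets_center[OF finq p k Nq this]
    obtain x where x: "x \<in> N" "M #> x \<noteq> M"
      and cen: "\<And>g. g \<in> carrier (G Mod M) \<Longrightarrow> g \<otimes>\<^bsub>G Mod M\<^esub> (M #> x) \<otimes>\<^bsub>G Mod M\<^esub> inv\<^bsub>G Mod M\<^esub> g = M #> x"
      by auto
    have xM: "x \<notin> M" using x M.coset_eq_one_iff[of x] by auto
    have "commutator G x g \<in> M" if g: "g \<in> carrier G" for g
    proof -
      have xc: "x \<in> carrier G" using x by auto
      have "M #> (g \<otimes> x \<otimes> inv g) = M #> x"
        using cen[of "M #> g"] g xc surj q.hom_mult[of "g \<otimes> x" "inv g"] q.hom_mult[of g x] q.hom_inv[of g]
        by (auto simp del: mult_FactGroup)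
      hence "M #> (x \<otimes> inv (g \<otimes> x \<otimes> inv g)) = M"
        using g xc q.hom_mult[of x "inv (g \<otimes> x \<otimes> inv g)"] q.hom_inv[of "g \<otimes> x \<otimes> inv g"]
          q.H.r_inv[OF q.hom_closed[OF xc]]
        by (simp del: mult_FactGroup q.hom_mult)
      hence "x \<otimes> inv (g \<otimes> x \<otimes> inv g) \<in> M"
        by (rule M.coset_eq_one_iff[THEN iffD1, rotated]) (use g xc in simp)
      thus ?thesis using g xc by (simp add: commutator_def inv_mult_group m_assoc)
    qed
    hence "x \<in> F" using x by (auto simp: F_def)
    thus ?thesis using xM by blast
  qed
  moreover have "F \<subseteq> N" by (auto simp: F_def)
  ultimately have "F = N" using max[of F] by auto
  hence "commutator_subgroup G N (carrier G) \<subseteq> M"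
    by (intro commutator_subgroup_least M.is_subgroup) (auto simp: F_def)
  thus False using eq M(2) by blast
qed

section \<open>The factors of the lower central series\<close>

context group begin

text \<open>With \<open>\<gamma>\<^sub>3\<close> trivial, \<open>D = \<gamma>\<^sub>2\<close> is central of index \<open>p\<^sup>2\<close>. If \<open>a\<close> is not central, its centralizer \<open>M\<close> lies
  strictly between \<open>D\<close> and \<open>G\<close>, so it has index \<open>p\<close> and is abelian. For \<open>b\<close> outside \<open>M\<close>, the homomorphism
  \<open>m \<mapsto> [m, b]\<close> on \<open>M\<close> kills \<open>D\<close>, so its image \<open>I\<close> has order dividing \<open>p\<close>. As \<open>M\<close> and \<open>b\<close> generate \<open>G\<close> and
  all their commutators are in \<open>I\<close>, the image is all of \<open>\<gamma>\<^sub>2\<close>.\<close>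
lemma card_lower_central_2_dvd_prime:
  assumes fin: "finite (carrier G)" and p: "prime p"
    and triv: "lower_central G 3 = {\<one>}"
    and ord: "Coset.order G = p ^ 2 * card (lower_central G 2)"
  shows "card (lower_central G 2) dvd p"
proof -
  define D where "D = lower_central G 2"
  have D: "subgroup D G" unfolding D_def by (rule lower_central_subgroup)
  interpret D: subgroup D G by (rule D)
  have central: "x \<otimes> g = g \<otimes> x" if "x \<in> D" "g \<in> carrier G" for x g
    using lower_central_trivial_next_commute[of 2 x g] triv that by (simp add: D_def numeral_3_eq_3 numeral_2_eq_2)
  have comm: "commutator G x g \<in> D" if "x \<in> carrier G" "g \<in> carrier G" for x g
    using commutator_mem_lower_central_2 that by (simp add: D_def)
  have least: "D \<subseteq> S" if "subgroup S G" "\<And>x g. x \<in> carrier G \<Longrightarrow> g \<in> carrier G \<Longrightarrow> commutator G x g \<in> S" for S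
    using lower_central_2_least[of S] that by (simp add: D_def)
  have cc: "commutator G x g \<otimes> h = h \<otimes> commutator G x g"
    if "x \<in> carrier G" "g \<in> carrier G" "h \<in> carrier G" for x g h
    using central[OF comm] that by simp
  show ?thesis
  proof (cases "\<forall>a\<in>carrier G. \<forall>h\<in>carrier G. a \<otimes> h = h \<otimes> a")
    case True
    have "D \<subseteq> {\<one>}" using True by (intro least triv_subgroup) (simp add: commutator_eq_one_iff)
    hence "D = {\<one>}" using D.one_closed by blast
    thus ?thesis by (simp add: D_def)
  next
    case False
    then obtain a b where a: "a \<in> carrier G" "b \<in> carrier G" "a \<otimes> b \<noteq> b \<otimes> a" by blast
    define M where "M = centralizer_in (carrier G) a"
    have M: "subgroup M G" unfolding M_def by (rule centralizer_in_subgroup[OF subgroup_self a(1)])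
    interpret M: subgroup M G by (rule M)
    have aM: "a \<in> M" using a(1) unfolding M_def centralizer_in_def by blast
    have aD: "a \<notin> D" using a(2,3) central[of a b] by blast
    have bM: "b \<notin> M" using a(3) unfolding M_def centralizer_in_def by auto
    have DM: "D \<subseteq> M"
    proof
      fix x assume "x \<in> D"
      thus "x \<in> M" unfolding M_def centralizer_in_def using central[OF _ a(1)] by simp
    qed
    have cardM: "card M = p * card D"
      using subgroup_between_prime_square_index[OF fin p D M DM] aM aD a(2) bM ord
      unfolding D_def by blast
    have abelian: "x \<otimes> y = y \<otimes> x" if x: "x \<in> M" and y: "y \<in> M" for x y
    proof -
      have xc: "x \<in> carrier G" using x by simp
      have "centralizer_in M x = D \<or> centralizer_in M x = M"
      proof (rule subgroup_between_prime_index[OF fin p D _ M _ _ cardM])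
        show "subgroup (centralizer_in M x) G" by (rule centralizer_in_subgroup[OF M xc])
        show "D \<subseteq> centralizer_in M x" unfolding centralizer_in_def using central[OF _ xc] DM by blast
      qed (auto simp: centralizer_in_def)
      moreover have "x \<otimes> a = a \<otimes> x" using x unfolding M_def centralizer_in_def by blast
      hence "a \<in> centralizer_in M x" using aM by (simp add: centralizer_in_def)
      ultimately have "y \<in> centralizer_in M x" using aD y by blast
      thus ?thesis by (simp add: centralizer_in_def)
    qed
    note b = a(2) bM
    \<comment> \<open>\<open>M\<close> and \<open>b\<close> generate \<open>G\<close>. The three facts \<open>gb\<close>, \<open>mg\<close>, \<open>gg\<close> below use this to spread membership in \<open>I\<close> from commutators of \<open>M\<close> and \<open>b\<close> to all commutators, one variable at a time.\<close>
    have span: "S = carrier G" if S: "subgroup S G" "M \<subseteq> S" "b \<in> S" for S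
    proof -
      have "card (carrier G) = p * card M" using ord cardM by (simp add: Coset.order_def D_def power2_eq_square)
      from subgroup_between_prime_index[OF fin p M S(1) subgroup_self S(2) _ this]
      show ?thesis using S b subgroup.subset[OF S(1)] by blast
    qed
    interpret f: group_hom "G\<lparr>carrier := carrier G\<rparr>" G "\<lambda>g. commutator G g b"
      by (rule commutator_hom_left[OF subgroup_self b(1)]) (use cc b in blast)
    define I where "I = (\<lambda>m. commutator G m b) ` M"
    have I: "subgroup I G" using f.subgroup_img_is_subgroup[of M] M by (simp add: I_def)
    interpret I: subgroup I G by (rule I)
    have gb: "commutator G g b \<in> I" if g: "g \<in> carrier G" for g
    proof -
      have "{x \<in> carrier G. commutator G x b \<in> I} = carrier G"
      proof (rule span)
        show "subgroup {x \<in> carrier G. commutator G x b \<in> I} G" using f.subgroup_preimage[OF I] by simp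
        have "commutator G b b = \<one>" using b by (simp add: commutator_eq_one_iff)
        thus "b \<in> {x \<in> carrier G. commutator G x b \<in> I}" using b by simp
      qed (auto simp: I_def)
      thus ?thesis using g by blast
    qed
    have mg: "commutator G m g \<in> I" if m: "m \<in> M" and g: "g \<in> carrier G" for m g
    proof -
      interpret k: group_hom G G "\<lambda>g. commutator G m g"
        by (rule commutator_hom_right) (use cc m in \<open>blast intro: M.mem_carrier\<close>)+
      have "{x \<in> carrier G. commutator G m x \<in> I} = carrier G"
      proof (rule span)
        show "subgroup {x \<in> carrier G. commutator G m x \<in> I} G" by (rule k.subgroup_preimage[OF I])
        have "commutator G m x = \<one>" if "x \<in> M" for x
          using abelian[OF m that] m that by (simp add: commutator_eq_one_iff)
        thus "M \<subseteq> {x \<in> carrier G. commutator G m x \<in> I}" by auto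
        show "b \<in> {x \<in> carrier G. commutator G m x \<in> I}" using b gb m by simp
      qed
      thus ?thesis using g by blast
    qed
    have gg: "commutator G g k \<in> I" if g: "g \<in> carrier G" and k: "k \<in> carrier G" for g k
    proof -
      interpret l: group_hom "G\<lparr>carrier := carrier G\<rparr>" G "\<lambda>g. commutator G g k"
        by (rule commutator_hom_left[OF subgroup_self k]) (use cc k in blast)
      have "{x \<in> carrier G. commutator G x k \<in> I} = carrier G"
      proof (rule span)
        show "subgroup {x \<in> carrier G. commutator G x k \<in> I} G" using l.subgroup_preimage[OF I] by simp
        show "M \<subseteq> {x \<in> carrier G. commutator G x k \<in> I}" using mg k by auto
        have "commutator G b k = inv (commutator G k b)" using b k by (simp add: commutator_inverse)
        thus "b \<in> {x \<in> carrier G. commutator G x k \<in> I}" using b gb[OF k] by simp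
      qed
      thus ?thesis using g by blast
    qed
    have "D \<subseteq> I" by (intro least I gg)
    moreover have "I \<subseteq> D" using comm b by (auto simp: I_def)
    ultimately have ID: "I = D" by blast
    have K: "subgroup {x \<in> M. commutator G x b = \<one>} G"
    proof -
      have "{x \<in> M. commutator G x b = \<one>} = centralizer_in M b"
        using b by (auto simp: centralizer_in_def commutator_eq_one_iff)
      thus ?thesis using centralizer_in_subgroup[OF M b(1)] by simp
    qed
    have "D \<subseteq> {x \<in> M. commutator G x b = \<one>}"
    proof
      fix x assume x: "x \<in> D"
      hence "commutator G x b = \<one>" using central[OF x b(1)] b by (simp add: commutator_eq_one_iff)
      thus "x \<in> {x \<in> M. commutator G x b = \<one>}" using x DM by blast
    qed
    then obtain k where k: "card {x \<in> M. commutator G x b = \<one>} = card D * k"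
      using card_subgroup_dvd[OF D K] by (auto simp: dvd_def)
    have "card I * card {x \<in> M. commutator G x b = \<one>} = card M"
      using f.card_image_mult_kernel[of M] fin M by (simp add: I_def)
    hence "card D * (card I * k) = card D * p" using k cardM by (simp add: mult_ac)
    moreover have "card D > 0" using D.finite_imp_card_positive[OF fin] .
    ultimately have "card I * k = p" by simp
    thus ?thesis using ID by (auto simp: D_def)
  qed
qed

text \<open>With \<open>\<gamma>\<^sub>4\<close> trivial, \<open>E = \<gamma>\<^sub>3\<close> is central, and \<open>D = \<gamma>\<^sub>2\<close> is generated by \<open>E\<close> and any \<open>c\<close> in \<open>D\<close> outside \<open>E\<close>.
  Hence \<open>g \<mapsto> [c, g]\<close> is a homomorphism whose image is a subgroup containing all commutators \<open>[x, g]\<close> with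
  \<open>x \<in> D\<close>, that is, equal to \<open>E\<close>. Its kernel contains \<open>D\<close>, so \<open>|E|\<close> divides \<open>|G : D| = p\<^sup>2\<close>; if
  \<open>|E| = p\<^sup>2\<close>, the kernel is no larger than \<open>D\<close>.\<close>
lemma card_lower_central_3_dvd_prime_square:
  assumes fin: "finite (carrier G)" and p: "prime p"
    and triv: "lower_central G 4 = {\<one>}"
    and ord: "Coset.order G = p ^ 2 * card (lower_central G 2)"
    and card2: "card (lower_central G 2) = p * card (lower_central G 3)"
  shows "card (lower_central G 3) dvd p ^ 2"
    and "\<lbrakk>card (lower_central G 3) = p ^ 2; b \<in> carrier G; b \<notin> lower_central G 2\<rbrakk>
      \<Longrightarrow> \<exists>c\<in>lower_central G 2. commutator G c b \<noteq> \<one>"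
proof -
  define D E where "D = lower_central G 2" and "E = lower_central G 3"
  have D: "subgroup D G" and E: "subgroup E G" unfolding D_def E_def by (rule lower_central_subgroup)+
  interpret D: subgroup D G by (rule D)
  interpret E: subgroup E G by (rule E)
  have ED: "E \<subseteq> D" using lower_central_Suc_subset[of 2] by (simp add: D_def E_def)
  have central: "x \<otimes> g = g \<otimes> x" if "x \<in> E" "g \<in> carrier G" for x g
    using lower_central_trivial_next_commute[of 3 x g] triv that by (simp add: E_def)
  have comm2: "commutator G x g \<in> D" if "x \<in> carrier G" "g \<in> carrier G" for x g
    using commutator_mem_lower_central_2 that by (simp add: D_def)
  have comm3: "commutator G x g \<in> E" if "x \<in> D" "g \<in> carrier G" for x g
    using commutator_mem_lower_central[of x 2 g] that by (simp add: D_def E_def)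
  have least2: "D \<subseteq> S" if "subgroup S G" "\<And>x g. x \<in> carrier G \<Longrightarrow> g \<in> carrier G \<Longrightarrow> commutator G x g \<in> S" for S
    using lower_central_2_least[of S] that by (simp add: D_def)
  have least3: "E \<subseteq> S" if "subgroup S G" "\<And>x g. x \<in> D \<Longrightarrow> g \<in> carrier G \<Longrightarrow> commutator G x g \<in> S" for S
    using lower_central_Suc_least[of 2 S] that by (simp add: D_def E_def)
  have cc: "commutator G x g \<otimes> h = h \<otimes> commutator G x g"
    if "x \<in> D" "g \<in> carrier G" "h \<in> carrier G" for x g h
    using central[OF comm3] that by simp
  have card: "card D = p * card E" using card2 by (simp add: D_def E_def)
  have posE: "card E > 0" using E.finite_imp_card_positive[OF fin] .
  have "D \<noteq> E" using card posE prime_gt_1_nat[OF p] by auto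
  then obtain c where c: "c \<in> D" "c \<notin> E" using ED by blast
  interpret f: group_hom G G "\<lambda>g. commutator G c g"
    by (rule commutator_hom_right) (use cc c D.mem_carrier in blast)+
  define J where "J = (\<lambda>g. commutator G c g) ` carrier G"
  have J: "subgroup J G" unfolding J_def by (rule f.img_is_subgroup)
  interpret J: subgroup J G by (rule J)
  have "commutator G x g \<in> J" if x: "x \<in> D" and g: "g \<in> carrier G" for x g
  proof -
    interpret l: group_hom "G\<lparr>carrier := D\<rparr>" G "\<lambda>x. commutator G x g"
      by (rule commutator_hom_left[OF D g]) (use cc g in blast)
    let ?S = "{x \<in> D. commutator G x g \<in> J}"
    have "?S = E \<or> ?S = D"
    proof (rule subgroup_between_prime_index[OF fin p E _ D _ _ card])
      have "subgroup ?S (G\<lparr>carrier := D\<rparr>)" using l.subgroup_preimage[OF J] by simp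
      thus "subgroup ?S G" by (rule incl_subgroup[OF D])
      show "E \<subseteq> ?S"
      proof
        fix y assume y: "y \<in> E"
        hence "commutator G y g = \<one>" using central[OF y g] y g by (simp add: commutator_eq_one_iff)
        thus "y \<in> ?S" using y ED by auto
      qed
    qed auto
    moreover have "c \<in> ?S" using c g by (auto simp: J_def)
    ultimately have "?S = D" using c by blast
    thus ?thesis using x by blast
  qed
  hence "E \<subseteq> J" by (intro least3 J)
  moreover have "J \<subseteq> E" using comm3 c by (auto simp: J_def)
  ultimately have JE: "J = E" by blast
  let ?K = "{g \<in> carrier G. commutator G c g = \<one>}"
  have K: "subgroup ?K G"
  proof -
    have "?K = {g \<in> carrier G. commutator G c g \<in> {\<one>}}" by simp
    thus ?thesis using f.subgroup_preimage[OF triv_subgroup] by simp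
  qed
  have DK: "D \<subseteq> ?K"
  proof (rule least2[OF K])
    fix x g assume xg: "x \<in> carrier G" "g \<in> carrier G"
    let ?x = "commutator G c x" and ?g = "commutator G c g"
    have "commutator G c (commutator G x g) = commutator G ?x ?g"
      using xg c by (simp add: commutator_def[of G x g] commutator_def[of G ?x ?g])
    also have "\<dots> = \<one>" using xg c cc[of c x ?g] by (subst commutator_eq_one_iff) auto
    finally show "commutator G x g \<in> ?K" using xg by simp
  qed
  have cardJK: "card E * card ?K = p ^ 2 * card D"
    using f.card_image_mult_kernel[OF fin subgroup_self] ord JE
    by (simp add: J_def Coset.order_def D_def)
  obtain k where k: "card ?K = card D * k" using card_subgroup_dvd[OF D K DK] by (auto simp: dvd_def)
  have posD: "card D > 0" using D.finite_imp_card_positive[OF fin] .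
  have "card D * (card E * k) = card D * p ^ 2" using cardJK k by (simp add: mult_ac)
  hence Ek: "card E * k = p ^ 2" using posD by simp
  thus "card (lower_central G 3) dvd p ^ 2" by (metis E_def dvd_triv_left)
  assume full: "card (lower_central G 3) = p ^ 2" and b: "b \<in> carrier G" "b \<notin> lower_central G 2"
  have "k = 1" using Ek full prime_gt_0_nat[OF p] by (simp add: E_def)
  hence "card D = card ?K" using k by simp
  have "finite ?K" using fin by simp
  from card_subset_eq[OF this DK \<open>card D = card ?K\<close>] have "D = ?K" .
  hence "b \<notin> ?K" using b(2) unfolding D_def by blast
  hence "commutator G c b \<noteq> \<one>" using b(1) by blast
  thus "\<exists>c\<in>lower_central G 2. commutator G c b \<noteq> \<one>" using c(1) unfolding D_def by blast
qed

end

section \<open>Extension of linear characters of abelian groups\<close>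

text \<open>The domain \<open>S\<close> is kept explicit because characters of several subgroups of one group are compared.
  Values are nonzero on a subgroup by multiplicativity, and values outside \<open>S\<close> are arbitrary.\<close>
definition linear_character :: "('a, 'b) monoid_scheme \<Rightarrow> 'a set \<Rightarrow> ('a \<Rightarrow> complex) \<Rightarrow> bool" where
  "linear_character G S \<mu> \<longleftrightarrow>
     \<mu> \<one>\<^bsub>G\<^esub> = 1 \<and> (\<forall>x\<in>S. \<forall>y\<in>S. \<mu> (x \<otimes>\<^bsub>G\<^esub> y) = \<mu> x * \<mu> y)"

lemma linear_character_one: "linear_character G S \<mu> \<Longrightarrow> \<mu> \<one>\<^bsub>G\<^esub> = 1"
  by (simp add: linear_character_def)

lemma linear_character_mult:
  "linear_character G S \<mu> \<Longrightarrow> x \<in> S \<Longrightarrow> y \<in> S \<Longrightarrow> \<mu> (x \<otimes>\<^bsub>G\<^esub> y) = \<mu> x * \<mu> y"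
  by (simp add: linear_character_def)

lemma linear_character_subset: "linear_character G S \<mu> \<Longrightarrow> T \<subseteq> S \<Longrightarrow> linear_character G T \<mu>"
  by (auto simp: linear_character_def)

lemma (in group) linear_character_nonzero:
  assumes "linear_character G S \<mu>" "subgroup S G" "x \<in> S" shows "\<mu> x \<noteq> 0"
proof -
  interpret S: subgroup S G by fact
  have "\<mu> x * \<mu> (inv x) = 1"
    using assms linear_character_mult[OF assms(1), of x "inv x"] linear_character_one[OF assms(1)] by simp
  thus ?thesis by auto
qed

text \<open>There are \<open>m\<close> roots, so at most one of them is lost by excluding \<open>1\<close>.\<close>
lemma nontrivial_root_exists:
  assumes "w \<noteq> (0::complex)" "m \<ge> 2"
  shows "\<exists>z. z ^ m = w \<and> z \<noteq> 1"
proof (rule ccontr)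
  assume "\<not> ?thesis"
  hence "{z. z ^ m = w} \<subseteq> {1}" by auto
  hence "card {z. z ^ m = w} \<le> 1" using card_mono[of "{1::complex}"] by auto
  thus False using card_nth_roots[OF assms(1), of m] assms(2) by simp
qed

text \<open>Let \<open>m\<close> be the order of \<open>x\<close> modulo \<open>B\<close>. Any \<open>m\<close>-th root \<open>\<zeta>\<close> of \<open>\<mu> (x\<^sup>m)\<close> can serve as the value at \<open>x\<close>, with
  \<open>b x\<^sup>k \<mapsto> \<mu> b * \<zeta>\<^sup>k\<close> as the extension to the subgroup generated by \<open>B\<close> and \<open>x\<close>. Since \<open>m \<ge> 2\<close>, there is a
  choice with \<open>\<zeta> \<noteq> 1\<close>.\<close>
lemma (in comm_group) linear_character_extend_one_step:
  assumes fin: "finite (carrier G)" and B: "subgroup B G" and \<mu>: "linear_character G B \<mu>"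
    and x: "x \<in> carrier G" "x \<notin> B"
  shows "\<exists>C \<nu>. subgroup C G \<and> B \<subseteq> C \<and> x \<in> C \<and> linear_character G C \<nu> \<and> (\<forall>b\<in>B. \<nu> b = \<mu> b) \<and> \<nu> x \<noteq> 1"
proof -
  interpret B: subgroup B G by fact
  define m where "m = (LEAST m::nat. m > 0 \<and> x [^] m \<in> B)"
  have "Coset.order G > 0" using fin order_gt_0_iff_finite by blast
  hence "Coset.order G > 0 \<and> x [^] (Coset.order G) \<in> B" using pow_order_eq_1[OF x(1)] by simp
  hence m: "m > 0" "x [^] m \<in> B" unfolding m_def by (rule LeastI2, simp, rule LeastI2, auto)
  have least: "\<And>k. k < m \<Longrightarrow> k > 0 \<Longrightarrow> x [^] k \<notin> B" unfolding m_def using not_less_Least by blast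
  have "m \<noteq> 1" using m x by auto
  hence m2: "m \<ge> 2" using m by simp
  obtain \<zeta> where \<zeta>: "\<zeta> ^ m = \<mu> (x [^] m)" "\<zeta> \<noteq> 1"
    using nontrivial_root_exists[OF linear_character_nonzero[OF \<mu> B m(2)] m2] by blast
  have powq: "x [^] (m * q) \<in> B \<and> \<mu> (x [^] (m * q)) = \<zeta> ^ (m * q)" for q
  proof (induction q)
    case 0 thus ?case using linear_character_one[OF \<mu>] by simp
  next
    case (Suc q)
    have "x [^] (m * Suc q) = x [^] m \<otimes> x [^] (m * q)" using x by (simp add: nat_pow_mult)
    thus ?case using Suc m \<zeta>(1) linear_character_mult[OF \<mu>, of "x [^] m" "x [^] (m*q)"]
      by (simp add: power_add)
  qed
  have dvd: "m dvd d" if "x [^] d \<in> B" for d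
  proof -
    have "x [^] d = x [^] (m * (d div m)) \<otimes> x [^] (d mod m)" using x by (simp add: nat_pow_mult)
    hence "x [^] (d mod m) = inv (x [^] (m * (d div m))) \<otimes> x [^] d"
      using x by (simp add: m_assoc[symmetric])
    hence "x [^] (d mod m) \<in> B" using that powq by auto
    hence "d mod m = 0" using least[of "d mod m"] m(1) by (metis gr0I mod_less_divisor)
    thus ?thesis by auto
  qed
  have wd_le: "\<mu> b * \<zeta> ^ k = \<mu> c * \<zeta> ^ l"
    if h: "b \<in> B" "c \<in> B" "b \<otimes> x [^] k = c \<otimes> x [^] l" "k \<le> l" for b c and k l :: nat
  proof -
    have "x [^] l = x [^] (l - k) \<otimes> x [^] k" using x h(4) by (simp add: nat_pow_mult)
    hence "b \<otimes> x [^] k = c \<otimes> x [^] (l - k) \<otimes> x [^] k" using h x by (simp add: m_assoc)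
    hence b: "b = c \<otimes> x [^] (l - k)" using h x by simp
    hence "x [^] (l - k) = inv c \<otimes> b" using h x by (simp add: m_assoc[symmetric])
    hence xB: "x [^] (l - k) \<in> B" using h by simp
    then obtain q where q: "l - k = m * q" using dvd by blast
    have "\<mu> b = \<mu> c * \<zeta> ^ (l - k)" using b linear_character_mult[OF \<mu> h(2) xB] powq[of q] q by simp
    thus ?thesis using h(4) by (simp add: power_add[symmetric])
  qed
  have wd: "\<mu> b * \<zeta> ^ k = \<mu> c * \<zeta> ^ l"
    if h: "b \<in> B" "c \<in> B" "b \<otimes> x [^] k = c \<otimes> x [^] l" for b c and k l :: nat
    using wd_le[OF h] wd_le[OF h(2,1) h(3)[symmetric]] by (cases "k \<le> l") auto
  define C where "C = {b \<otimes> x [^] k | b k. b \<in> B \<and> k \<in> (UNIV::nat set)}"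
  define \<nu> where "\<nu> y = (SOME z. \<exists>b (k::nat). b \<in> B \<and> y = b \<otimes> x [^] k \<and> z = \<mu> b * \<zeta> ^ k)" for y
  have \<nu>: "\<nu> (b \<otimes> x [^] k) = \<mu> b * \<zeta> ^ k" if "b \<in> B" for b and k :: nat
    unfolding \<nu>_def
  proof (rule someI2[of _ "\<mu> b * \<zeta> ^ k"])
    show "\<exists>c l. c \<in> B \<and> b \<otimes> x [^] k = c \<otimes> x [^] (l::nat) \<and> \<mu> b * \<zeta> ^ k = \<mu> c * \<zeta> ^ l"
      using that by blast
    fix z assume "\<exists>c (l::nat). c \<in> B \<and> b \<otimes> x [^] k = c \<otimes> x [^] l \<and> z = \<mu> c * \<zeta> ^ l"
    then obtain c and l :: nat where c: "c \<in> B" "b \<otimes> x [^] k = c \<otimes> x [^] l" "z = \<mu> c * \<zeta> ^ l" by blast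
    show "z = \<mu> b * \<zeta> ^ k" using wd[OF that c(1,2)] c(3) by simp
  qed
  have BC: "B \<subseteq> C"
  proof
    fix b assume "b \<in> B" hence "b = b \<otimes> x [^] (0::nat)" by simp
    thus "b \<in> C" using \<open>b \<in> B\<close> unfolding C_def by blast
  qed
  have prod: "(b \<otimes> x [^] k) \<otimes> (c \<otimes> x [^] l) = (b \<otimes> c) \<otimes> x [^] (k + l)"
    if "b \<in> B" "c \<in> B" for b c and k l :: nat
  proof -
    have c: "b \<in> carrier G" "c \<in> carrier G" "x [^] k \<in> carrier G" "x [^] l \<in> carrier G" using that x by auto
    have "x [^] (k + l) = x [^] k \<otimes> x [^] l" using x by (simp add: nat_pow_mult)
    thus ?thesis using c by (simp only: m_ac m_closed)
  qed
  have "subgroup C G"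
  proof (rule subgroupI)
    show "C \<subseteq> carrier G" using x by (auto simp: C_def)
    show "C \<noteq> {}" using BC B.one_closed by blast
    show "u \<otimes> v \<in> C" if uv: "u \<in> C" "v \<in> C" for u v
    proof -
      obtain b c and k l :: nat where bc: "b \<in> B" "u = b \<otimes> x [^] k" "c \<in> B" "v = c \<otimes> x [^] l"
        using uv unfolding C_def by blast
      have "u \<otimes> v = (b \<otimes> c) \<otimes> x [^] (k + l)" using bc prod by simp
      moreover have "b \<otimes> c \<in> B" using bc by simp
      ultimately show ?thesis unfolding C_def by blast
    qed
    fix u assume "u \<in> C"
    then obtain b k where u: "b \<in> B" "u = b \<otimes> x [^] (k::nat)" unfolding C_def by blast
    \<comment> \<open>The exponents in \<open>C\<close> are natural numbers, so \<open>x\<^sup>-\<^sup>k\<close> is written as \<open>x\<^sup>m\<^sup>k\<^sup>-\<^sup>k\<close> times the inverse of \<open>x\<^sup>m\<^sup>k \<in> B\<close>.\<close>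
    let ?l = "m * k - k"
    have "k \<le> m * k" using m(1) by simp
    hence e: "x [^] k \<otimes> x [^] ?l = x [^] (m * k)" using x by (simp add: nat_pow_mult)
    have "inv (x [^] k) = x [^] ?l \<otimes> inv (x [^] (m * k))"
    proof (rule inv_equality)
      show "x [^] ?l \<otimes> inv (x [^] (m * k)) \<otimes> x [^] k = \<one>"
      proof -
        have c: "x [^] ?l \<in> carrier G" "x [^] k \<in> carrier G" "inv (x [^] (m * k)) \<in> carrier G" using x by auto
        have "x [^] ?l \<otimes> inv (x [^] (m * k)) \<otimes> x [^] k = inv (x [^] (m * k)) \<otimes> (x [^] k \<otimes> x [^] ?l)"
          using c by (simp only: m_ac m_closed)
        thus ?thesis using x e by simp
      qed
    qed (use x in auto)
    hence "inv u = (inv b \<otimes> inv (x [^] (m * k))) \<otimes> x [^] ?l"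
    proof -
      have c: "x [^] ?l \<in> carrier G" "inv b \<in> carrier G" "inv (x [^] (m * k)) \<in> carrier G" using x u by auto
      have "inv u = inv b \<otimes> inv (x [^] k)" using u x by (simp add: inv_mult)
      also have "\<dots> = inv b \<otimes> (x [^] ?l \<otimes> inv (x [^] (m * k)))" using \<open>inv (x [^] k) = _\<close> by simp
      finally show ?thesis using c by (simp only: m_ac m_closed)
    qed
    thus "inv u \<in> C" unfolding C_def using u powq[of k] by blast
  qed
  moreover have "x \<in> C"
  proof -
    have "x = \<one> \<otimes> x [^] (1::nat)" using x by simp
    thus ?thesis unfolding C_def using B.one_closed by blast
  qed
  moreover have \<nu>B: "\<forall>b\<in>B. \<nu> b = \<mu> b"
  proof
    fix b assume b: "b \<in> B" show "\<nu> b = \<mu> b" using \<nu>[OF b, of 0] b by simp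
  qed
  moreover have "linear_character G C \<nu>"
    unfolding linear_character_def
  proof (intro conjI ballI)
    show "\<nu> \<one> = 1" using \<nu>B B.one_closed linear_character_one[OF \<mu>] by simp
    fix u v assume "u \<in> C" "v \<in> C"
    then obtain b k c l where u: "b \<in> B" "u = b \<otimes> x [^] (k::nat)" "c \<in> B" "v = c \<otimes> x [^] (l::nat)"
      unfolding C_def by blast
    show "\<nu> (u \<otimes> v) = \<nu> u * \<nu> v"
      using u \<nu> prod linear_character_mult[OF \<mu>, of b c] by (simp add: power_add)
  qed
  moreover have "\<nu> x \<noteq> 1"
    using \<nu>[OF B.one_closed, of 1] x \<zeta>(2) linear_character_one[OF \<mu>] by simp
  ultimately show ?thesis using BC by blast
qed

text \<open>The first step enforces the nontrivial value at \<open>y\<close>; afterwards the character is extended over a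
  maximal subgroup, which must be the whole group.\<close>
lemma (in comm_group) linear_character_extend:
  assumes fin: "finite (carrier G)" and B: "subgroup B G" and \<mu>: "linear_character G B \<mu>"
    and y: "y \<in> carrier G" "y \<notin> B"
  shows "\<exists>\<nu>. linear_character G (carrier G) \<nu> \<and> (\<forall>b\<in>B. \<nu> b = \<mu> b) \<and> \<nu> y \<noteq> 1"
proof -
  let ?P = "\<lambda>C. subgroup C G \<and> B \<subseteq> C \<and> y \<in> C \<and>
     (\<exists>\<nu>. linear_character G C \<nu> \<and> (\<forall>b\<in>B. \<nu> b = \<mu> b) \<and> \<nu> y \<noteq> 1)"
  have "finite (Collect ?P)"
    using fin by (rule finite_subset[rotated, OF finite_Pow_iff[THEN iffD2]]) (auto dest: subgroup.subset)
  have "\<exists>C. ?P C" using linear_character_extend_one_step[OF fin B \<mu> y] by blast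
  hence "Collect ?P \<noteq> {}" by blast
  from finite_has_maximal[OF \<open>finite (Collect ?P)\<close> this]
  obtain C where C: "?P C" and max: "\<And>D. ?P D \<Longrightarrow> C \<subseteq> D \<Longrightarrow> C = D" by auto
  obtain \<nu> where \<nu>: "linear_character G C \<nu>" "\<forall>b\<in>B. \<nu> b = \<mu> b" "\<nu> y \<noteq> 1" using C by blast
  have "C = carrier G"
  proof (rule ccontr)
    assume "C \<noteq> carrier G"
    then obtain x where x: "x \<in> carrier G" "x \<notin> C" using C subgroup.subset by blast
    obtain D \<nu>' where D: "subgroup D G" "C \<subseteq> D" "x \<in> D" "linear_character G D \<nu>'" "\<forall>c\<in>C. \<nu>' c = \<nu> c"
      using linear_character_extend_one_step[OF fin _ \<nu>(1) x] C by blast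
    have "?P D" using D C \<nu> by (intro conjI exI[of _ \<nu>']) (auto simp: subset_iff)
    from max[OF this D(2)] show False using D x by blast
  qed
  thus ?thesis using \<nu> by blast
qed

section \<open>A linear character of the commutator subgroup with trivial stabilizer\<close>

context group begin

text \<open>The inertia group of \<open>\<mu>\<close>, for \<open>S\<close> normal.\<close>
definition stabilizer_of_character :: "'a set \<Rightarrow> ('a \<Rightarrow> complex) \<Rightarrow> 'a set" where
  "stabilizer_of_character S \<mu> = {g \<in> carrier G. \<forall>x\<in>S. \<mu> (g \<otimes> x \<otimes> inv g) = \<mu> x}"

lemma stabilizer_of_character_subgroup:
  assumes "S \<lhd> G" shows "subgroup (stabilizer_of_character S \<mu>) G"
proof -
  interpret S: normal S G by fact
  show ?thesis
  proof (rule subgroupI)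
    show "stabilizer_of_character S \<mu> \<subseteq> carrier G" by (auto simp: stabilizer_of_character_def)
    have "\<one> \<in> stabilizer_of_character S \<mu>" by (simp add: stabilizer_of_character_def)
    thus "stabilizer_of_character S \<mu> \<noteq> {}" by blast
    fix g assume "g \<in> stabilizer_of_character S \<mu>"
    hence g: "g \<in> carrier G" "\<And>x. x \<in> S \<Longrightarrow> \<mu> (g \<otimes> x \<otimes> inv g) = \<mu> x"
      by (auto simp: stabilizer_of_character_def)
    have "\<mu> (inv g \<otimes> x \<otimes> inv (inv g)) = \<mu> x" if x: "x \<in> S" for x
    proof -
      have "inv g \<otimes> x \<otimes> g \<in> S" using g(1) x by (rule S.inv_op_closed1)
      from g(2)[OF this] show ?thesis using g(1) x by (simp add: m_assoc)
    qed
    thus "inv g \<in> stabilizer_of_character S \<mu>" using g(1) by (simp add: stabilizer_of_character_def)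
    fix h assume "h \<in> stabilizer_of_character S \<mu>"
    hence h: "h \<in> carrier G" "\<And>x. x \<in> S \<Longrightarrow> \<mu> (h \<otimes> x \<otimes> inv h) = \<mu> x"
      by (auto simp: stabilizer_of_character_def)
    have "\<mu> (g \<otimes> h \<otimes> x \<otimes> inv (g \<otimes> h)) = \<mu> x" if x: "x \<in> S" for x
    proof -
      have "h \<otimes> x \<otimes> inv h \<in> S" using h(1) x by (rule S.inv_op_closed2)
      from g(2)[OF this] show ?thesis using g(1) h x by (simp add: m_assoc inv_mult_group)
    qed
    thus "g \<otimes> h \<in> stabilizer_of_character S \<mu>" using g(1) h(1) by (simp add: stabilizer_of_character_def)
  qed
qed

lemma conj_character:
  assumes "linear_character G S \<mu>" "x \<in> S" "x \<in> carrier G" "g \<in> carrier G" "commutator G g x \<in> S"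
  shows "\<mu> (g \<otimes> x \<otimes> inv g) = \<mu> (commutator G g x) * \<mu> x"
  using assms linear_character_mult[OF assms(1), of "commutator G g x" x] by (simp add: conj_eq_commutator_mult)

lemma abelian_subgroup_character_extend:
  assumes fin: "finite (carrier G)" and D: "subgroup D G"
    and ab: "\<And>x y. x \<in> D \<Longrightarrow> y \<in> D \<Longrightarrow> x \<otimes> y = y \<otimes> x"
    and B: "subgroup B G" "B \<subseteq> D" and \<mu>: "linear_character G B \<mu>" and y: "y \<in> D" "y \<notin> B"
  shows "\<exists>\<nu>. linear_character G D \<nu> \<and> (\<forall>b\<in>B. \<nu> b = \<mu> b) \<and> \<nu> y \<noteq> 1"
proof -
  interpret GD: comm_group "G\<lparr>carrier := D\<rparr>"
    by (rule group.group_comm_groupI[OF subgroup_imp_group[OF D]]) (simp add: ab)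
  have "finite (carrier (G\<lparr>carrier := D\<rparr>))" using fin subgroup.subset[OF D] finite_subset by auto
  moreover have "subgroup B (G\<lparr>carrier := D\<rparr>)" by (rule subgroup_incl[OF B(1) D B(2)])
  moreover have "linear_character (G\<lparr>carrier := D\<rparr>) B \<mu>" using \<mu> by (simp add: linear_character_def)
  ultimately obtain \<nu> where "linear_character (G\<lparr>carrier := D\<rparr>) D \<nu>" "\<forall>b\<in>B. \<nu> b = \<mu> b" "\<nu> y \<noteq> 1"
    using GD.linear_character_extend[of B \<mu> y] y by auto
  thus ?thesis by (auto simp: linear_character_def)
qed

text \<open>Here \<open>D = \<gamma>\<^sub>2\<close>, \<open>E = \<gamma>\<^sub>3\<close>, \<open>Z = \<gamma>\<^sub>4\<close>, and \<open>Z\<close> is central. Then \<open>E\<close> commutes with \<open>D\<close>, because for \<open>x \<in> E\<close> the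
  homomorphism \<open>g \<mapsto> [x, g]\<close> has central values and so kills \<open>G'\<close>; as \<open>|D : E| = p\<close>, it follows that \<open>D\<close> is abelian. The
  stabilizer of the restriction of a character to \<open>E\<close> depends only on its values on \<open>Z \<supseteq> [E, G]\<close>, which leaves
  the freedom to change the values on the rest of \<open>D\<close> and so to shrink the stabilizer on \<open>D\<close>.\<close>
lemma exists_character_with_trivial_stabilizer:
  assumes fin: "finite (carrier G)" and p: "prime p"
    and triv: "lower_central G 5 = {\<one>}" and nontriv: "lower_central G 4 \<noteq> {\<one>}"
    and ord: "Coset.order G = p ^ 2 * card (lower_central G 2)"
    and card2: "card (lower_central G 2) = p * card (lower_central G 3)"
    and noncentral: "\<And>b. b \<in> carrier G \<Longrightarrow> b \<notin> lower_central G 2 \<Longrightarrow>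
      \<exists>c\<in>lower_central G 2. commutator G c b \<notin> lower_central G 4"
  shows "\<exists>\<mu>. linear_character G (lower_central G 2) \<mu> \<and>
    stabilizer_of_character (lower_central G 2) \<mu> = lower_central G 2"
proof -
  define D E Z where "D = lower_central G 2" and "E = lower_central G 3" and "Z = lower_central G 4"
  have norm: "D \<lhd> G" "E \<lhd> G" "Z \<lhd> G" unfolding D_def E_def Z_def by (rule lower_central_normal)+
  hence D: "subgroup D G" and E: "subgroup E G" and Z: "subgroup Z G" by (auto dest: normal_imp_subgroup)
  interpret D: subgroup D G by (rule D)
  interpret E: subgroup E G by (rule E)
  interpret Z: subgroup Z G by (rule Z)
  have ED: "E \<subseteq> D" using lower_central_Suc_subset[of 2] by (simp add: D_def E_def)
  have ZE: "Z \<subseteq> E" using lower_central_Suc_subset[of 3] by (simp add: Z_def E_def)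
  have central: "x \<otimes> g = g \<otimes> x" if "x \<in> Z" "g \<in> carrier G" for x g
    using lower_central_trivial_next_commute[of 4 x g] triv that by (simp add: Z_def)
  have comm3: "commutator G x g \<in> E" if "x \<in> D" "g \<in> carrier G" for x g
    using commutator_mem_lower_central[of x 2 g] that by (simp add: D_def E_def)
  have comm4: "commutator G x g \<in> Z" if "x \<in> E" "g \<in> carrier G" for x g
    using commutator_mem_lower_central[of x 3 g] that by (simp add: Z_def E_def)
  have comm4': "commutator G g x \<in> Z" if "x \<in> E" "g \<in> carrier G" for x g
    using commutator_mem_lower_central'[of x 3 g] that by (simp add: Z_def E_def)
  have least2: "D \<subseteq> S" if "subgroup S G" "\<And>x g. x \<in> carrier G \<Longrightarrow> g \<in> carrier G \<Longrightarrow> commutator G x g \<in> S" for S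
    using lower_central_2_least[of S] that by (simp add: D_def)
  have least4: "Z \<subseteq> S" if "subgroup S G" "\<And>x g. x \<in> E \<Longrightarrow> g \<in> carrier G \<Longrightarrow> commutator G x g \<in> S" for S
    using lower_central_Suc_least[of 3 S] that by (simp add: Z_def E_def)
  have card: "card D = p * card E" using card2 by (simp add: D_def E_def)
  have "card E > 0" using E.finite_imp_card_positive[OF fin] .
  hence "D \<noteq> E" using card prime_gt_1_nat[OF p] by auto
  then obtain c0 where c0: "c0 \<in> D" "c0 \<notin> E" using ED by blast
  have ED_commute: "x \<otimes> y = y \<otimes> x" if x: "x \<in> E" and y: "y \<in> D" for x y
  proof -
    interpret f: group_hom G G "\<lambda>g. commutator G x g"
      by (rule commutator_hom_right) (use central[OF comm4[OF x]] E.mem_carrier[OF x] in blast)+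
    have "D \<subseteq> {g \<in> carrier G. commutator G x g \<in> {\<one>}}"
    proof (rule least2[OF f.subgroup_preimage[OF triv_subgroup]])
      fix u v assume uv: "u \<in> carrier G" "v \<in> carrier G"
      let ?u = "commutator G x u" and ?v = "commutator G x v"
      have "commutator G x (commutator G u v) = commutator G ?u ?v"
        using uv x by (simp add: commutator_def[of G u v] commutator_def[of G ?u ?v])
      also have "\<dots> = \<one>"
        using uv x central[OF comm4[OF x uv(1)], of ?v] by (subst commutator_eq_one_iff) auto
      finally show "commutator G u v \<in> {g \<in> carrier G. commutator G x g \<in> {\<one>}}" using uv by simp
    qed
    hence "commutator G x y = \<one>" using y by auto
    thus ?thesis using x y by (simp add: commutator_eq_one_iff)
  qed
  \<comment> \<open>Used twice: for \<open>y = c0\<close>, to see that \<open>c0\<close> commutes with all of \<open>D\<close>, and then for arbitrary \<open>y\<close> with witness \<open>w = c0\<close>.\<close>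
  have centD: "centralizer_in D y = D" if y: "y \<in> D" and w: "w \<in> D" "w \<notin> E" "w \<otimes> y = y \<otimes> w" for y w
  proof -
    have "centralizer_in D y = E \<or> centralizer_in D y = D"
    proof (rule subgroup_between_prime_index[OF fin p E _ D _ _ card])
      show "subgroup (centralizer_in D y) G" using y by (intro centralizer_in_subgroup[OF D]) simp
      show "E \<subseteq> centralizer_in D y" unfolding centralizer_in_def using ED ED_commute[OF _ y] by blast
    qed (auto simp: centralizer_in_def)
    moreover have "w \<in> centralizer_in D y" using w by (simp add: centralizer_in_def)
    ultimately show ?thesis using w by blast
  qed
  have c0comm: "x \<otimes> c0 = c0 \<otimes> x" if "x \<in> D" for x
    using centD[OF c0(1) c0 refl] that unfolding centralizer_in_def by blast
  have abelian: "x \<otimes> y = y \<otimes> x" if "x \<in> D" "y \<in> D" for x y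
    using centD[OF that(2) c0 c0comm[OF that(2), symmetric]] that unfolding centralizer_in_def by blast
  let ?St = stabilizer_of_character
  have "\<exists>x0\<in>E. \<exists>g0\<in>carrier G. commutator G x0 g0 \<noteq> \<one>"
  proof (rule ccontr)
    assume "\<not> ?thesis"
    hence "Z \<subseteq> {\<one>}" by (intro least4 triv_subgroup) auto
    thus False using nontriv Z.one_closed by (auto simp: Z_def)
  qed
  then obtain x0 g0 where x0: "x0 \<in> E" "g0 \<in> carrier G" and "commutator G x0 g0 \<noteq> \<one>" by blast
  hence ne: "commutator G g0 x0 \<noteq> \<one>" by (simp add: commutator_eq_one_iff)
  have z0: "commutator G g0 x0 \<in> D" using comm4'[OF x0] ZE ED by blast
  have "linear_character G {\<one>} (\<lambda>_. 1)" by (simp add: linear_character_def)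
  from abelian_subgroup_character_extend[OF fin D abelian triv_subgroup _ this z0] ne
  obtain \<mu>0 where \<mu>0: "linear_character G D \<mu>0" "\<mu>0 (commutator G g0 x0) \<noteq> 1" by auto
  have nz: "\<mu> x \<noteq> 0" if "linear_character G D \<mu>" "x \<in> D" for \<mu> x
    using linear_character_nonzero[OF that(1) D that(2)] .
  have conj: "\<mu> (g \<otimes> x \<otimes> inv g) = \<mu> x \<longleftrightarrow> \<mu> (commutator G g x) = 1"
    if "linear_character G D \<mu>" "x \<in> D" "g \<in> carrier G" for \<mu> x g
  proof -
    have "commutator G g x \<in> D"
    proof -
      have "inv (commutator G x g) \<in> D" using comm3[OF that(2,3)] ED by blast
      thus ?thesis using that by (simp add: commutator_inverse)
    qed
    hence "\<mu> (g \<otimes> x \<otimes> inv g) = \<mu> (commutator G g x) * \<mu> x"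
      by (intro conj_character[OF that(1,2) _ that(3)]) (use that in simp_all)
    thus ?thesis using nz[OF that(1,2)] by simp
  qed
  have D_stab: "D \<subseteq> ?St D \<mu>" if \<mu>: "linear_character G D \<mu>" for \<mu>
  proof
    fix g assume g: "g \<in> D"
    have "\<mu> (g \<otimes> x \<otimes> inv g) = \<mu> x" if x: "x \<in> D" for x
    proof -
      have "g \<otimes> x \<otimes> inv g = x" using abelian[OF x g] g x by (intro conj_of_commuting) auto
      thus ?thesis by simp
    qed
    thus "g \<in> ?St D \<mu>" using g by (simp add: stabilizer_of_character_def)
  qed
  have mono: "?St D \<mu> \<subseteq> ?St E \<mu>" for \<mu> using ED by (auto simp: stabilizer_of_character_def)
  define K where "K = ?St E \<mu>0"
  have K: "subgroup K G" unfolding K_def by (rule stabilizer_of_character_subgroup[OF norm(2)])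
  have DK: "D \<subseteq> K" using D_stab[OF \<mu>0(1)] mono by (auto simp: K_def)
  have "g0 \<notin> K" using conj[OF \<mu>0(1), of x0 g0] \<mu>0(2) x0 ED by (auto simp: K_def stabilizer_of_character_def)
  hence Kproper: "K \<noteq> carrier G" using x0(2) by blast
  show ?thesis
  proof (cases "K = D")
    case True
    hence "?St D \<mu>0 = D" using D_stab[OF \<mu>0(1)] mono[of \<mu>0] by (auto simp: K_def)
    thus ?thesis using \<mu>0(1) by (auto simp: D_def)
  next
    case False
    then obtain b where b: "b \<in> K" "b \<notin> D" using DK by blast
    have bc: "b \<in> carrier G" using b(1) by (simp add: K_def stabilizer_of_character_def)
    obtain c where c: "c \<in> D" "commutator G c b \<notin> Z"
      using noncentral[OF bc] b(2) by (auto simp: D_def Z_def)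
    have inv: "inv (commutator G b c) = commutator G c b" using c bc by (simp add: commutator_inverse)
    have y1: "commutator G b c \<in> D"
    proof -
      have "inv (commutator G c b) \<in> D" using comm3[OF c(1) bc] ED by blast
      thus ?thesis using c bc by (simp add: commutator_inverse)
    qed
    have y2: "commutator G b c \<notin> Z" using c(2) Z.m_inv_closed[of "commutator G b c"] inv by auto
    have ZD: "Z \<subseteq> D" using ZE ED by blast
    \<comment> \<open>The new character agrees with \<open>\<mu>0\<close> on \<open>Z\<close> only, and \<open>b\<close> no longer stabilizes it.\<close>
    from abelian_subgroup_character_extend[OF fin D abelian Z ZD linear_character_subset[OF \<mu>0(1) ZD] y1 y2]
    obtain \<mu> where \<mu>: "linear_character G D \<mu>" "\<forall>z\<in>Z. \<mu> z = \<mu>0 z" "\<mu> (commutator G b c) \<noteq> 1" by blast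
    \<comment> \<open>Both conditions say that the character is trivial on the elements \<open>[g, x]\<close> of \<open>Z\<close> with \<open>x \<in> E\<close>.\<close>
    have "g \<in> ?St E \<mu> \<longleftrightarrow> g \<in> K" for g
    proof -
      have "\<mu> (g \<otimes> x \<otimes> inv g) = \<mu> x \<longleftrightarrow> \<mu>0 (g \<otimes> x \<otimes> inv g) = \<mu>0 x"
        if g: "g \<in> carrier G" and x: "x \<in> E" for x
      proof -
        have "x \<in> D" using x ED by blast
        thus ?thesis using conj[OF \<mu>(1) _ g] conj[OF \<mu>0(1) _ g] \<mu>(2) comm4'[OF x g] by simp
      qed
      thus ?thesis unfolding K_def stabilizer_of_character_def by blast
    qed
    hence "?St E \<mu> = K" by blast
    hence TK: "?St D \<mu> \<subseteq> K" using mono by blast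
    have "b \<notin> ?St D \<mu>" using conj[OF \<mu>(1) c(1) bc] \<mu>(3) c(1) by (auto simp: stabilizer_of_character_def)
    hence "?St D \<mu> \<noteq> K" using b by blast
    moreover have "card K = p * card D"
      using subgroup_between_prime_square_index[OF fin p D K DK False Kproper] ord by (simp add: D_def)
    ultimately have "?St D \<mu> = D"
      using subgroup_between_prime_index[OF fin p D stabilizer_of_character_subgroup[OF norm(1)] K D_stab[OF \<mu>(1)] TK]
      by blast
    thus ?thesis using \<mu>(1) by (auto simp: D_def)
  qed
qed

end

section \<open>Monomial induction\<close>

context group begin

text \<open>Left cosets are what the matrices below need, whereas quotients are built from right cosets; for a normal
  subgroup the two agree.\<close>
lemma normal_transversal_exists:
  assumes fin: "finite (carrier G)" and A: "A \<lhd> G"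
  shows "\<exists>t. (\<forall>i<card (rcosets A). t i \<in> carrier G) \<and>
    (\<forall>g\<in>carrier G. \<exists>!i. i < card (rcosets A) \<and> inv (t i) \<otimes> g \<in> A)"
proof -
  interpret A: normal A G by fact
  have fc: "finite (rcosets A)" using fin by (simp add: RCOSETS_def)
  obtain f where f: "bij_betw f {0..<card (rcosets A)} (rcosets A)"
    using ex_bij_betw_nat_finite[OF fc] by blast
  have ex: "\<exists>g\<in>carrier G. f i = A #> g" if "i < card (rcosets A)" for i
    using bij_betwE[OF f] that by (auto simp: RCOSETS_def)
  then obtain t where t: "\<And>i. i < card (rcosets A) \<Longrightarrow> t i \<in> carrier G \<and> f i = A #> t i"
    by metis
  have iff: "inv (t i) \<otimes> g \<in> A \<longleftrightarrow> f i = A #> g" if i: "i < card (rcosets A)" and g: "g \<in> carrier G" for i g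
  proof -
    have ti: "t i \<in> carrier G" "f i = A #> t i" using t i by auto
    have "inv (t i) \<otimes> g \<in> A \<longleftrightarrow> t i \<otimes> (inv (t i) \<otimes> g) \<otimes> inv (t i) \<in> A"
    proof
      assume "inv (t i) \<otimes> g \<in> A" thus "t i \<otimes> (inv (t i) \<otimes> g) \<otimes> inv (t i) \<in> A"
        using ti by (simp only: A.inv_op_closed2)
    next
      assume "t i \<otimes> (inv (t i) \<otimes> g) \<otimes> inv (t i) \<in> A"
      hence "inv (t i) \<otimes> (t i \<otimes> (inv (t i) \<otimes> g) \<otimes> inv (t i)) \<otimes> t i \<in> A"
        using ti by (simp only: A.inv_op_closed1)
      moreover have "inv (t i) \<otimes> (t i \<otimes> (inv (t i) \<otimes> g) \<otimes> inv (t i)) \<otimes> t i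
          = (inv (t i) \<otimes> t i) \<otimes> (inv (t i) \<otimes> g) \<otimes> (inv (t i) \<otimes> t i)"
        using ti g by (simp only: m_assoc m_closed inv_closed)
      ultimately show "inv (t i) \<otimes> g \<in> A" using ti g by simp
    qed
    also have "t i \<otimes> (inv (t i) \<otimes> g) \<otimes> inv (t i) = g \<otimes> inv (t i)"
      using ti g by (simp add: m_assoc[symmetric])
    also have "g \<otimes> inv (t i) \<in> A \<longleftrightarrow> g \<in> A #> t i"
      using A.rcos_module[OF is_group ti(1) g] by simp
    also have "\<dots> \<longleftrightarrow> A #> t i = A #> g"
      using repr_independence[OF _ ti(1) A.is_subgroup] rcos_self[OF g A.is_subgroup] by auto
    finally show ?thesis using ti by simp
  qed
  have "\<exists>!i. i < card (rcosets A) \<and> inv (t i) \<otimes> g \<in> A" if g: "g \<in> carrier G" for g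
  proof -
    have "A #> g \<in> rcosets A" using g by (auto simp: RCOSETS_def)
    then obtain i where i: "i < card (rcosets A)" "f i = A #> g"
      using f unfolding bij_betw_def by (metis atLeastLessThan_iff imageE)
    have "j = i" if "j < card (rcosets A)" "f j = A #> g" for j
      using f i that unfolding bij_betw_def inj_on_def by simp
    thus ?thesis using i iff g by blast
  qed
  thus ?thesis by (intro exI[of _ t] conjI allI impI ballI) (simp_all add: t)
qed

end

text \<open>A linear character \<open>\<mu>\<close> of the normal subgroup \<open>A\<close>, together with representatives \<open>t 0, ..., t (n - 1)\<close> of the
  left cosets of \<open>A\<close>.\<close>
locale monomial_induction = group G for G (structure) +
  fixes A :: "'a set" and \<mu> :: "'a \<Rightarrow> complex" and n :: nat and t :: "nat \<Rightarrow> 'a"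
  assumes normalA: "A \<lhd> G" and chr: "linear_character G A \<mu>"
    and t_closed: "\<And>i. i < n \<Longrightarrow> t i \<in> carrier G"
    and t_unique: "\<And>g. g \<in> carrier G \<Longrightarrow> \<exists>!i. i < n \<and> inv (t i) \<otimes> g \<in> A"
begin

sublocale A: normal A G by (rule normalA)

definition extension_by_zero :: "'a \<Rightarrow> complex" where "extension_by_zero y = (if y \<in> A then \<mu> y else 0)"

definition induced :: "'a \<Rightarrow> complex mat" where
  "induced g = mat n n (\<lambda>(i, j). extension_by_zero (inv (t i) \<otimes> g \<otimes> t j))"

lemma induced_carrier [simp]: "induced g \<in> carrier_mat n n"
  "dim_row (induced g) = n" "dim_col (induced g) = n"
  by (auto simp: induced_def)

lemma extension_by_zero_mult:
  assumes "x \<in> carrier G" "y \<in> A" shows "extension_by_zero (x \<otimes> y) = extension_by_zero x * \<mu> y"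
proof (cases "x \<in> A")
  case True thus ?thesis using assms linear_character_mult[OF chr] by (simp add: extension_by_zero_def)
next
  case False
  have "x \<otimes> y \<notin> A"
  proof
    assume "x \<otimes> y \<in> A"
    hence "(x \<otimes> y) \<otimes> inv y \<in> A" using assms by simp
    thus False using assms False by (simp add: m_assoc)
  qed
  thus ?thesis using False by (simp add: extension_by_zero_def)
qed

text \<open>Only one index \<open>k\<close> contributes to an entry of the product: the one whose coset \<open>t k A\<close> contains \<open>h t j\<close>.\<close>
lemma induced_mult:
  assumes g: "g \<in> carrier G" and h: "h \<in> carrier G"
  shows "induced (g \<otimes> h) = induced g * induced h"
proof (rule eq_matI)
  fix i j assume "i < dim_row (induced g * induced h)" "j < dim_col (induced g * induced h)"
  hence ij: "i < n" "j < n" by auto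
  note c = t_closed[OF ij(1)] t_closed[OF ij(2)] g h
  obtain k where k: "k < n" "inv (t k) \<otimes> (h \<otimes> t j) \<in> A"
    and uniq: "\<And>l. l < n \<Longrightarrow> inv (t l) \<otimes> (h \<otimes> t j) \<in> A \<Longrightarrow> l = k"
    using t_unique[of "h \<otimes> t j"] c by blast
  have "(induced g * induced h) $$ (i, j) =
      (\<Sum>l\<in>{0..<n}. extension_by_zero (inv (t i) \<otimes> g \<otimes> t l) * extension_by_zero (inv (t l) \<otimes> h \<otimes> t j))"
    using ij by (simp add: scalar_prod_def induced_def)
  also have "\<dots> = (\<Sum>l\<in>{0..<n}. if l = k then extension_by_zero (inv (t i) \<otimes> g \<otimes> t k) * extension_by_zero (inv (t k) \<otimes> h \<otimes> t j) else 0)"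
  proof (rule sum.cong)
    fix l assume l: "l \<in> {0..<n}"
    have "extension_by_zero (inv (t l) \<otimes> h \<otimes> t j) = 0" if "l \<noteq> k"
      using uniq[of l] that l c t_closed[of l] by (auto simp: extension_by_zero_def m_assoc)
    thus "extension_by_zero (inv (t i) \<otimes> g \<otimes> t l) * extension_by_zero (inv (t l) \<otimes> h \<otimes> t j) =
      (if l = k then extension_by_zero (inv (t i) \<otimes> g \<otimes> t k) * extension_by_zero (inv (t k) \<otimes> h \<otimes> t j) else 0)" by auto
  qed simp
  also have "\<dots> = extension_by_zero (inv (t i) \<otimes> g \<otimes> t k) * extension_by_zero (inv (t k) \<otimes> h \<otimes> t j)" using k by simp
  also have "\<dots> = extension_by_zero ((inv (t i) \<otimes> g \<otimes> t k) \<otimes> (inv (t k) \<otimes> h \<otimes> t j))"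
    using extension_by_zero_mult[of "inv (t i) \<otimes> g \<otimes> t k" "inv (t k) \<otimes> h \<otimes> t j"] k c t_closed[OF k(1)]
    by (simp add: extension_by_zero_def m_assoc)
  also have "(inv (t i) \<otimes> g \<otimes> t k) \<otimes> (inv (t k) \<otimes> h \<otimes> t j)
      = inv (t i) \<otimes> g \<otimes> (t k \<otimes> inv (t k)) \<otimes> h \<otimes> t j"
    using c t_closed[OF k(1)] by (simp only: m_assoc m_closed inv_closed)
  also have "\<dots> = inv (t i) \<otimes> (g \<otimes> h) \<otimes> t j"
    using c t_closed[OF k(1)] by (simp add: m_assoc)
  finally show "induced (g \<otimes> h) $$ (i, j) = (induced g * induced h) $$ (i, j)"
    using ij by (simp add: induced_def)
qed auto

lemma t_eq_iff:
  assumes ij: "i < n" "j < n" shows "inv (t i) \<otimes> t j \<in> A \<longleftrightarrow> i = j"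
proof
  have j: "inv (t j) \<otimes> t j \<in> A" using t_closed[OF ij(2)] by simp
  show "i = j" if "inv (t i) \<otimes> t j \<in> A"
    using t_unique[OF t_closed[OF ij(2)]] ij that j by blast
  show "inv (t i) \<otimes> t j \<in> A" if "i = j" using that j by simp
qed

text \<open>Elements of \<open>A\<close> act diagonally, through the conjugates of \<open>\<mu>\<close>. This is what makes invariant subspaces
  accessible.\<close>
lemma induced_diagonal:
  assumes x: "x \<in> A" and ij: "i < n" "j < n"
  shows "induced x $$ (i, j) = (if i = j then \<mu> (inv (t i) \<otimes> x \<otimes> t i) else 0)"
proof -
  note c = t_closed[OF ij(1)] t_closed[OF ij(2)] A.mem_carrier[OF x]
  have "inv (t i) \<otimes> x \<otimes> t j = (inv (t i) \<otimes> x \<otimes> t i) \<otimes> (inv (t i) \<otimes> t j)"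
    using c by (simp add: m_assoc)
  moreover have "inv (t i) \<otimes> x \<otimes> t i \<in> A" using c x by (simp add: A.inv_op_closed1)
  ultimately have "inv (t i) \<otimes> x \<otimes> t j \<in> A \<longleftrightarrow> inv (t i) \<otimes> t j \<in> A"
    by (metis A.m_closed A.m_inv_closed c inv_closed inv_solve_left m_closed)
  thus ?thesis using ij t_eq_iff[OF ij] by (auto simp: induced_def extension_by_zero_def)
qed

lemma induced_one: "induced \<one> = 1\<^sub>m n"
proof (rule eq_matI)
  fix i j assume "i < dim_row (1\<^sub>m n :: complex mat)" "j < dim_col (1\<^sub>m n :: complex mat)"
  thus "induced \<one> $$ (i, j) = 1\<^sub>m n $$ (i, j)"
    using induced_diagonal[OF A.one_closed, of i j] t_closed[of j] linear_character_one[OF chr] by auto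
qed auto

lemma induced_representation: "complex_representation G n induced"
proof -
  have "induced g \<in> Units (ring_mat TYPE(complex) n ())" if g: "g \<in> carrier G" for g
  proof -
    have "induced (inv g) * induced g = 1\<^sub>m n" "induced g * induced (inv g) = 1\<^sub>m n"
      using g induced_mult[of g "inv g"] induced_mult[of "inv g" g] induced_one by auto
    thus ?thesis unfolding Units_def ring_mat_def by (auto intro!: bexI[of _ "induced (inv g)"])
  qed
  thus ?thesis unfolding complex_representation_def complex_GL_def hom_def
    by (auto simp: units_of_carrier units_of_mult induced_mult ring_mat_def)
qed

lemma induced_permutes_basis:
  assumes ij: "i < n" "k < n"
  shows "induced (t k \<otimes> inv (t i)) *\<^sub>v unit_vec n i = unit_vec n k"
proof (rule eq_vecI)
  fix l assume "l < dim_vec (unit_vec n k :: complex vec)"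
  hence l: "l < n" by simp
  note c = t_closed[OF ij(1)] t_closed[OF ij(2)] t_closed[OF l]
  have "(induced (t k \<otimes> inv (t i)) *\<^sub>v unit_vec n i) $ l = induced (t k \<otimes> inv (t i)) $$ (l, i)"
    using l ij by (simp add: scalar_prod_right_unit)
  also have "\<dots> = extension_by_zero (inv (t l) \<otimes> t k)" using l ij c by (simp add: induced_def m_assoc)
  also have "\<dots> = unit_vec n k $ l"
    using t_eq_iff[OF l ij(2)] l ij c linear_character_one[OF chr] by (auto simp: extension_by_zero_def)
  finally show "(induced (t k \<otimes> inv (t i)) *\<^sub>v unit_vec n i) $ l = unit_vec n k $ l" .
qed auto

text \<open>If only \<open>A\<close> fixes \<open>\<mu>\<close>, the diagonal characters of \<open>A\<close> are pairwise distinct. A nonzero vector of \<open>W\<close> with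
  smallest support then has just one nonzero coordinate: if it had two, some \<open>induced x - c\<close> with \<open>x \<in> A\<close> would
  kill one and keep the other. So \<open>W\<close> contains a basis vector, and \<open>G\<close> permutes the basis lines transitively.\<close>
lemma invariant_subspace_trivial:
  assumes stab: "\<And>g. g \<in> carrier G \<Longrightarrow> g \<notin> A \<Longrightarrow> \<exists>x\<in>A. \<mu> (g \<otimes> x \<otimes> inv g) \<noteq> \<mu> x"
    and W: "VectorSpace.subspace class_ring W (module_vec TYPE(complex) n)"
    and inv: "\<And>g w. g \<in> carrier G \<Longrightarrow> w \<in> W \<Longrightarrow> induced g *\<^sub>v w \<in> W"
    and ne: "W \<noteq> {0\<^sub>v n}"
  shows "W = carrier_vec n"
proof -
  interpret W: submodule class_ring W "module_vec TYPE(complex) n"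
    using W by (simp add: VectorSpace.subspace_def)
  have Wsub: "w \<in> carrier_vec n" if "w \<in> W" for w
    using W.subset that by (auto simp: module_vec_def)
  have Wadd: "v + w \<in> W" if "v \<in> W" "w \<in> W" for v w
    using W.m_closed[OF that] by (simp add: module_vec_def)
  have Wzero: "0\<^sub>v n \<in> W" using W.zero_closed by (simp add: module_vec_def)
  have Wsmult: "c \<cdot>\<^sub>v w \<in> W" if "w \<in> W" for c w
    using W.smult_closed[of c w] that by (simp add: module_vec_def class_ring_simps)
  let ?supp = "\<lambda>w::complex vec. {i. i < n \<and> w $ i \<noteq> 0}"
  obtain w0 where "w0 \<in> W \<and> w0 \<noteq> 0\<^sub>v n" using ne Wzero by blast
  from ex_has_least_nat[of "\<lambda>w. w \<in> W \<and> w \<noteq> 0\<^sub>v n", OF this, of "\<lambda>w. card (?supp w)"]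
  obtain w where w: "w \<in> W" "w \<noteq> 0\<^sub>v n"
    and min: "\<And>u. u \<in> W \<Longrightarrow> u \<noteq> 0\<^sub>v n \<Longrightarrow> card (?supp w) \<le> card (?supp u)"
    by blast
  have dw: "dim_vec w = n" using Wsub[OF w(1)] by auto
  obtain i where i: "i < n" "w $ i \<noteq> 0"
    using w(2) dw by (metis eq_vecI index_zero_vec)
  have single: "w $ j = 0" if j: "j < n" "j \<noteq> i" for j
  proof (rule ccontr)
    assume wj: "w $ j \<noteq> 0"
    have ij: "inv (t i) \<otimes> t j \<in> carrier G" "inv (t i) \<otimes> t j \<notin> A"
      using t_closed i j t_eq_iff[of i j] by auto
    then obtain y where y: "y \<in> A" "\<mu> (inv (t i) \<otimes> t j \<otimes> y \<otimes> inv (inv (t i) \<otimes> t j)) \<noteq> \<mu> y"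
      using stab by blast
    have c: "t i \<in> carrier G" "t j \<in> carrier G" "y \<in> carrier G" using t_closed i j y by auto
    \<comment> \<open>The \<open>j\<close>-th diagonal character takes the value \<open>\<mu> y\<close> at \<open>x\<close>, the \<open>i\<close>-th one does not.\<close>
    define x where "x = t j \<otimes> y \<otimes> inv (t j)"
    have xA: "x \<in> A" using y c by (simp add: x_def A.inv_op_closed2)
    have xj: "inv (t j) \<otimes> x \<otimes> t j = y"
      using c by (simp add: x_def m_assoc)
    have xi: "inv (t i) \<otimes> x \<otimes> t i = inv (t i) \<otimes> t j \<otimes> y \<otimes> inv (inv (t i) \<otimes> t j)"
      using c by (simp add: x_def m_assoc inv_mult_group)
    define u where "u = induced x *\<^sub>v w + (- \<mu> y) \<cdot>\<^sub>v w"
    have uW: "u \<in> W" unfolding u_def using w xA inv by (intro Wadd Wsmult) auto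
    have uk: "u $ k = (\<mu> (inv (t k) \<otimes> x \<otimes> t k) - \<mu> y) * w $ k" if k: "k < n" for k
    proof -
      have "(induced x *\<^sub>v w) $ k = (\<Sum>l\<in>{0..<n}. induced x $$ (k, l) * w $ l)"
        using k dw by (simp add: scalar_prod_def)
      also have "\<dots> = (\<Sum>l\<in>{0..<n}. if l = k then \<mu> (inv (t k) \<otimes> x \<otimes> t k) * w $ k else 0)"
        using k by (intro sum.cong) (auto simp: induced_diagonal[OF xA])
      also have "\<dots> = \<mu> (inv (t k) \<otimes> x \<otimes> t k) * w $ k" using k by simp
      finally show ?thesis using k dw by (simp add: u_def algebra_simps)
    qed
    have "u $ i \<noteq> 0" using uk[OF i(1)] i(2) y(2) xi by simp
    hence "u \<noteq> 0\<^sub>v n" using i by auto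
    hence "card (?supp w) \<le> card (?supp u)" using min uW by blast
    moreover have "?supp u \<subset> ?supp w"
    proof
      show "?supp u \<subseteq> ?supp w" using uk by auto
      have "j \<in> ?supp w" "j \<notin> ?supp u" using j wj uk[OF j(1)] xj by auto
      thus "?supp u \<noteq> ?supp w" by blast
    qed
    hence "card (?supp u) < card (?supp w)" by (intro psubset_card_mono) auto
    ultimately show False by simp
  qed
  have "(1 / w $ i) \<cdot>\<^sub>v w = unit_vec n i"
    using i single dw by (intro eq_vecI) auto
  hence ei: "unit_vec n i \<in> W" using Wsmult[OF w(1), of "1 / w $ i"] by simp
  have ek: "unit_vec n k \<in> W" if "k < n" for k
    using inv[OF _ ei, of "t k \<otimes> inv (t i)"] induced_permutes_basis[OF i(1) that] t_closed i that by auto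
  have "v \<in> W" if v: "v \<in> carrier_vec n" for v
  proof -
    have "vec n (\<lambda>l. if l < m then v $ l else 0) \<in> W" if "m \<le> n" for m
      using that
    proof (induction m)
      case 0
      have "vec n (\<lambda>l. if l < 0 then v $ l else 0) = 0\<^sub>v n" by auto
      thus ?case using Wzero by simp
    next
      case (Suc m)
      have "vec n (\<lambda>l. if l < Suc m then v $ l else 0)
          = vec n (\<lambda>l. if l < m then v $ l else 0) + v $ m \<cdot>\<^sub>v unit_vec n m"
        using Suc.prems by (intro eq_vecI) (auto simp: less_Suc_eq)
      thus ?case using Suc Wadd Wsmult ek by simp
    qed
    moreover have "vec n (\<lambda>l. if l < n then v $ l else 0) = v" using v by (intro eq_vecI) auto
    ultimately show ?thesis by (metis order_refl)
  qed
  thus ?thesis using Wsub by blast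
qed

end

lemma (in group) exists_irreducible_representation_of_degree_index:
  assumes fin: "finite (carrier G)" and A: "A \<lhd> G" and chr: "linear_character G A \<mu>"
    and stab: "\<And>g. g \<in> carrier G \<Longrightarrow> g \<notin> A \<Longrightarrow> \<exists>x\<in>A. \<mu> (g \<otimes> x \<otimes> inv g) \<noteq> \<mu> x"
  shows "\<exists>\<rho>. irreducible_representation G (card (rcosets A)) \<rho>"
proof -
  obtain t where t: "\<forall>i<card (rcosets A). t i \<in> carrier G"
    "\<forall>g\<in>carrier G. \<exists>!i. i < card (rcosets A) \<and> inv (t i) \<otimes> g \<in> A"
    using normal_transversal_exists[OF fin A] by blast
  interpret m: monomial_induction G A \<mu> "card (rcosets A)" t
  proof (intro monomial_induction.intro monomial_induction_axioms.intro is_group A chr)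
    show "t i \<in> carrier G" if "i < card (rcosets A)" for i using t(1) that by simp
    show "\<exists>!i. i < card (rcosets A) \<and> inv t i \<otimes> g \<in> A" if "g \<in> carrier G" for g
      by (rule bspec[OF t(2) that])
  qed
  have "A \<in> rcosets A" by (rule m.A.subgroup_in_rcosets[OF is_group])
  moreover have "finite (rcosets A)" using fin by (simp add: RCOSETS_def)
  ultimately have "card (rcosets A) > 0" by (auto simp: card_gt_0_iff)
  thus ?thesis unfolding irreducible_representation_def
    using m.induced_representation m.invariant_subspace_trivial[OF stab] by blast
qed

lemma (in group_hom) irreducible_representation_pullback:
  assumes surj: "h ` carrier G = carrier H" and irr: "irreducible_representation H n \<rho>"
  shows "irreducible_representation G n (\<rho> \<circ> h)"
proof -
  have "\<rho> \<in> hom H (complex_GL n)"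
    using irr unfolding irreducible_representation_def complex_representation_def by (rule conjunct1)
  with homh have "\<rho> \<circ> h \<in> hom G (complex_GL n)" by (rule Group.hom_compose)
  moreover have "W = {0\<^sub>v n} \<or> W = carrier_vec n"
    if W: "VectorSpace.subspace class_ring W (module_vec TYPE(complex) n)"
      and inv: "\<forall>g\<in>carrier G. \<forall>w\<in>W. (\<rho> \<circ> h) g *\<^sub>v w \<in> W" for W
  proof -
    have "\<forall>g\<in>carrier H. \<forall>w\<in>W. \<rho> g *\<^sub>v w \<in> W"
      using inv unfolding surj[symmetric] by simp
    with W irr show ?thesis unfolding irreducible_representation_def by metis
  qed
  moreover have "n > 0" using irr unfolding irreducible_representation_def by metis
  ultimately show ?thesis
    unfolding irreducible_representation_def complex_representation_def by blast
qed

lemma irreducible_representation_imp_character: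
  assumes "group G" "irreducible_representation G n \<rho>"
  shows "\<exists>\<chi>. irreducible_character G \<chi> \<and> character_degree G \<chi> = of_nat n"
proof -
  let ?\<chi> = "\<lambda>g. mat_trace (\<rho> g)"
  have hom: "\<rho> \<in> hom G (complex_GL n)"
    using assms(2) unfolding irreducible_representation_def complex_representation_def by (rule conjunct1)
  interpret R: ring "ring_mat TYPE(complex) n ()" by (rule ring_mat)
  have "group (complex_GL n)" unfolding complex_GL_def by (rule R.units_group)
  hence "\<rho> \<one>\<^bsub>G\<^esub> = \<one>\<^bsub>complex_GL n\<^esub>" using hom_one[OF hom assms(1)] by simp
  hence "\<rho> \<one>\<^bsub>G\<^esub> = 1\<^sub>m n" by (simp add: complex_GL_def units_of_one ring_mat_def)
  hence "character_degree G ?\<chi> = of_nat n" by (simp add: character_degree_def mat_trace_def)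
  moreover have "irreducible_character G ?\<chi>" unfolding irreducible_character_def using assms(2) by blast
  ultimately show ?thesis by blast
qed

section \<open>Quotients by terms of the lower central series\<close>

context group begin

lemma lower_central_antimono: "i \<le> k \<Longrightarrow> lower_central G k \<subseteq> lower_central G i"
  by (rule lift_Suc_antimono_le[where f = "lower_central G", OF lower_central_Suc_subset])

lemma order_FactGroup_mult: "subgroup N G \<Longrightarrow> Coset.order (G Mod N) * card N = Coset.order G"
  using lagrange by (simp add: Coset.order_def FactGroup_def)

lemma coset_hom_lower_central:
  fixes k defines "N \<equiv> lower_central G k"
  shows "group_hom G (G Mod N) (\<lambda>x. N #> x)"
    and "lower_central (G Mod N) i = (\<lambda>x. N #> x) ` lower_central G i"
proof -
  interpret N: normal N G unfolding N_def by (rule lower_central_normal)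
  show hom: "group_hom G (G Mod N) (\<lambda>x. N #> x)" by (rule N.coset_group_hom)
  show "lower_central (G Mod N) i = (\<lambda>x. N #> x) ` lower_central G i"
    by (rule group_hom.image_lower_central[OF hom, symmetric]) (simp add: carrier_FactGroup)
qed

text \<open>For \<open>i \<le> k\<close> the coset map identifies the \<open>i\<close>-th term of the series of the quotient with the image of a subgroup
  that contains the kernel, so membership can be tested on representatives.\<close>
lemma coset_mem_lower_central_quotient_iff:
  fixes k defines "N \<equiv> lower_central G k"
  assumes "i \<le> k" "x \<in> carrier G"
  shows "N #> x \<in> lower_central (G Mod N) i \<longleftrightarrow> x \<in> lower_central G i"
proof
  interpret N: normal N G unfolding N_def by (rule lower_central_normal)
  interpret L: subgroup "lower_central G i" G by (rule lower_central_subgroup)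
  assume "N #> x \<in> lower_central (G Mod N) i"
  then obtain y where y: "y \<in> lower_central G i" "N #> x = N #> y"
    unfolding N_def coset_hom_lower_central(2) by blast
  have "x \<in> N #> y" using rcos_self[OF assms(3) N.is_subgroup] y by simp
  then obtain z where "z \<in> N" "x = z \<otimes> y" by (auto simp: r_coset_def)
  thus "x \<in> lower_central G i" using y lower_central_antimono[OF assms(2)] by (auto simp: N_def)
next
  assume "x \<in> lower_central G i"
  thus "N #> x \<in> lower_central (G Mod N) i" unfolding N_def coset_hom_lower_central(2) by blast
qed

lemma card_lower_central_quotient:
  assumes fin: "finite (carrier G)" and "i \<le> k"
  shows "card (lower_central (G Mod lower_central G k) i) * card (lower_central G k) = card (lower_central G i)"
proof -
  let ?N = "lower_central G k"
  interpret N: normal ?N G by (rule lower_central_normal)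
  interpret q: group_hom G "G Mod ?N" "\<lambda>x. ?N #> x" by (rule coset_hom_lower_central)
  have "{x \<in> lower_central G i. ?N #> x = ?N} = ?N"
    using N.coset_eq_one_iff lower_central_antimono[OF assms(2)] lower_central_closed by blast
  thus ?thesis
    using q.card_image_mult_kernel[OF fin lower_central_subgroup, of i] by (simp add: coset_hom_lower_central(2))
qed

lemma lower_central_quotient_trivial: "lower_central (G Mod lower_central G k) k = {\<one>\<^bsub>G Mod lower_central G k\<^esub>}"
proof -
  interpret N: normal "lower_central G k" G by (rule lower_central_normal)
  have "(\<lambda>x. lower_central G k #> x) ` lower_central G k = {lower_central G k}"
  proof
    show "(\<lambda>x. lower_central G k #> x) ` lower_central G k \<subseteq> {lower_central G k}"
      by (intro image_subsetI) (simp add: N.coset_eq_one_iff)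
    have "lower_central G k #> \<one> = lower_central G k" using N.subset by (rule coset_mult_one)
    thus "{lower_central G k} \<subseteq> (\<lambda>x. lower_central G k #> x) ` lower_central G k"
      using N.one_closed by (metis image_eqI singletonD subsetI)
  qed
  thus ?thesis by (simp add: coset_hom_lower_central(2))
qed

lemma p_group_lower_central_stationary_imp_trivial:
  assumes "finite (carrier G)" "prime p" "Coset.order G = p ^ n" "i \<ge> 1"
    "card (lower_central G (Suc i)) = card (lower_central G i)"
  shows "lower_central G i = {\<one>}"
proof -
  have "finite (lower_central G i)"
    using assms(1) subgroup.subset[OF lower_central_subgroup] finite_subset by blast
  hence "lower_central G (Suc i) = lower_central G i"
    by (rule card_subset_eq[OF _ lower_central_Suc_subset assms(5)])
  hence "commutator_subgroup G (lower_central G i) (carrier G) = lower_central G i"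
    by (simp only: lower_central_Suc[OF assms(4)])
  thus ?thesis by (rule p_group_commutator_subgroup_fixed_imp_trivial[OF assms(1-3) lower_central_normal])
qed

text \<open>The hypothesis on the index of \<open>\<gamma>\<^sub>2\<close> passes to the quotients in which the previous lemmas are applied.\<close>
lemma index_lower_central_quotient:
  assumes "finite (carrier G)" "2 \<le> k" "Coset.order G = m * card (lower_central G 2)"
  shows "Coset.order (G Mod lower_central G k) = m * card (lower_central (G Mod lower_central G k) 2)"
proof -
  have "card (lower_central G k) > 0"
    using subgroup.finite_imp_card_positive[OF lower_central_subgroup assms(1)] .
  moreover have "Coset.order (G Mod lower_central G k) * card (lower_central G k)
     = m * card (lower_central (G Mod lower_central G k) 2) * card (lower_central G k)"
    using order_FactGroup_mult[OF lower_central_subgroup] card_lower_central_quotient[OF assms(1,2)] assms(3)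
    by (simp add: mult.assoc)
  ultimately show ?thesis by simp
qed

end

section \<open>Characters of degree the square of p\<close>

theorem theorem3:
  fixes G :: "('a, 'b) monoid_scheme" and p :: nat
  assumes "prime p"
    and "finite_p_group p G"
    and "Coset.order (G Mod derived G (carrier G)) = p ^ 2"
    and "Coset.order G \<ge> p ^ 6"
  shows "(Coset.order (G\<lparr>carrier := lower_central G 3\<rparr> Mod lower_central G 4) > p \<longleftrightarrow>
            Coset.order (G Mod lower_central G 4) = p ^ 5) \<and>
         (Coset.order (G\<lparr>carrier := lower_central G 3\<rparr> Mod lower_central G 4) > p \<longrightarrow>
            (\<exists>\<chi>. irreducible_character G \<chi> \<and> character_degree G \<chi> = of_nat (p ^ 2)))"
proof -
  note p = \<open>prime p\<close>
  have p1: "p > 1" using prime_gt_1_nat[OF p] .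
  interpret G: group G using assms(2) by (simp add: finite_p_group_def)
  have fin: "finite (carrier G)" using assms(2) by (simp add: finite_p_group_def)
  obtain n where n: "Coset.order G = p ^ n" using assms(2) by (auto simp: finite_p_group_def)
  define g where "g i = card (lower_central G i)" for i
  have gpos: "g i > 0" for i
    unfolding g_def using subgroup.finite_imp_card_positive[OF G.lower_central_subgroup fin] .
  have stationary: "lower_central G i = {\<one>\<^bsub>G\<^esub>}" if "i \<ge> 1" "j = Suc i" "g j = g i" for i j
    using G.p_group_lower_central_stationary_imp_trivial[OF fin p n that(1)] that(2,3) by (simp add: g_def)
  have ord: "Coset.order G = p ^ 2 * g 2"
    using G.order_FactGroup_mult[OF G.lower_central_subgroup[of 2]] assms(3) lower_central_2[of G]
    by (simp add: g_def)
  have "g 2 \<noteq> 1"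
  proof
    assume "g 2 = 1"
    hence "p ^ 6 \<le> p ^ 2" using ord assms(4) by simp
    thus False using p1 by simp
  qed
  have ne23: "g 3 \<noteq> g 2"
  proof
    assume "g 3 = g 2"
    hence "lower_central G 2 = {\<one>\<^bsub>G\<^esub>}" by (intro stationary[of 2 3]) simp_all
    thus False using \<open>g 2 \<noteq> 1\<close> by (simp add: g_def)
  qed
  let ?Q = "\<lambda>k. G Mod lower_central G k"
  have grpQ: "group (?Q k)" for k using group_hom.axioms(2)[OF G.coset_hom_lower_central(1)] .
  have finQ: "finite (carrier (?Q k))" for k using fin by (simp add: carrier_FactGroup)
  have cardQ: "card (lower_central (?Q k) i) * g k = g i" if "i \<le> k" for i k
    using G.card_lower_central_quotient[OF fin that] by (simp add: g_def)
  have ordQ: "Coset.order (?Q k) = p ^ 2 * card (lower_central (?Q k) 2)" if "2 \<le> k" for k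
    using G.index_lower_central_quotient[OF fin that] ord by (simp add: g_def)
  \<comment> \<open>Each estimate is read off in the quotient in which the next term of the series is trivial.\<close>
  have "card (lower_central (?Q 3) 2) dvd p"
    by (rule group.card_lower_central_2_dvd_prime[OF grpQ finQ p G.lower_central_quotient_trivial ordQ]) simp
  hence "card (lower_central (?Q 3) 2) = 1 \<or> card (lower_central (?Q 3) 2) = p"
    using p by (simp add: prime_nat_iff)
  hence g2: "g 2 = p * g 3" using cardQ[of 2 3] ne23 by auto
  have card2: "card (lower_central (?Q k) 2) = p * card (lower_central (?Q k) 3)" if "3 \<le> k" for k
  proof -
    have "card (lower_central (?Q k) 2) * g k = p * card (lower_central (?Q k) 3) * g k"
      using cardQ[of 2 k] cardQ[of 3 k] that g2 by (simp add: mult.assoc)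
    thus ?thesis using gpos[of k] by simp
  qed
  define r where "r = Coset.order (G\<lparr>carrier := lower_central G 3\<rparr> Mod lower_central G 4)"
  have r: "r * g 4 = g 3"
  proof -
    interpret L: group "G\<lparr>carrier := lower_central G 3\<rparr>"
      by (rule G.subgroup_imp_group[OF G.lower_central_subgroup])
    have "subgroup (lower_central G 4) (G\<lparr>carrier := lower_central G 3\<rparr>)"
      by (intro G.subgroup_incl G.lower_central_subgroup G.lower_central_antimono) simp
    from L.order_FactGroup_mult[OF this] show ?thesis by (simp add: r_def g_def Coset.order_def)
  qed
  have rQ: "card (lower_central (?Q 4) 3) = r"
  proof -
    have "card (lower_central (?Q 4) 3) * g 4 = r * g 4" using cardQ[of 3 4] r by simp
    thus ?thesis using gpos[of 4] by simp
  qed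
  have B: "card (lower_central (?Q 4) 3) dvd p ^ 2"
    by (rule group.card_lower_central_3_dvd_prime_square(1)[OF grpQ finQ p G.lower_central_quotient_trivial ordQ card2]) simp_all
  then obtain i where i: "i \<le> 2" "r = p ^ i" using p rQ by (auto simp: divides_primepow_nat)
  have r_iff: "r > p \<longleftrightarrow> r = p ^ 2"
  proof
    assume "r > p"
    hence "p ^ 1 < p ^ i" using i by simp
    hence "1 < i" using p1 power_strict_increasing_iff by blast
    hence "i = 2" using i(1) by linarith
    thus "r = p ^ 2" using i(2) by simp
  next
    assume "r = p ^ 2" thus "r > p" using p1 by (simp add: power2_eq_square)
  qed
  have ordG4: "Coset.order (?Q 4) = p ^ 3 * r"
  proof -
    have "Coset.order (?Q 4) * g 4 = p ^ 3 * r * g 4"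
      using G.order_FactGroup_mult[OF G.lower_central_subgroup[of 4]] ord g2 r[symmetric]
      by (simp add: g_def power2_eq_square power3_eq_cube mult.assoc)
    thus ?thesis using gpos[of 4] by simp
  qed
  have "p ^ 3 * r = p ^ 5 \<longleftrightarrow> r = p ^ 2"
  proof -
    have "p ^ 5 = p ^ 3 * p ^ 2" by (simp flip: power_add)
    thus ?thesis using p1 by (simp only: mult_cancel1) simp
  qed
  hence first: "r > p \<longleftrightarrow> Coset.order (?Q 4) = p ^ 5" using r_iff ordG4 by simp
  have second: "\<exists>\<chi>. irreducible_character G \<chi> \<and> character_degree G \<chi> = of_nat (p ^ 2)" if "r > p"
  proof -
    have rp: "r = p ^ 2" using that r_iff by simp
    have ord4: "Coset.order G = p ^ 5 * g 4"
      using ord g2 r[symmetric] rp by (simp add: power2_eq_square eval_nat_numeral mult.assoc)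
    have "g 4 \<noteq> 1"
    proof
      assume "g 4 = 1"
      hence "p ^ 6 \<le> p ^ 5" using ord4 assms(4) by simp
      thus False using p1 by simp
    qed
    have ne45: "g 5 \<noteq> g 4"
    proof
      assume "g 5 = g 4"
      hence "lower_central G 4 = {\<one>\<^bsub>G\<^esub>}" by (intro stationary[of 4 5]) simp_all
      thus False using \<open>g 4 \<noteq> 1\<close> by (simp add: g_def)
    qed
    interpret q4: group_hom G "?Q 4" "\<lambda>x. lower_central G 4 #>\<^bsub>G\<^esub> x" by (rule G.coset_hom_lower_central)
    interpret q5: group_hom G "?Q 5" "\<lambda>x. lower_central G 5 #>\<^bsub>G\<^esub> x" by (rule G.coset_hom_lower_central)
    have nontriv: "lower_central (?Q 5) 4 \<noteq> {\<one>\<^bsub>?Q 5\<^esub>}"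
    proof
      assume "lower_central (?Q 5) 4 = {\<one>\<^bsub>?Q 5\<^esub>}"
      thus False using cardQ[of 4 5] ne45 by simp
    qed
    \<comment> \<open>This is the case of equality in \<open>G / \<gamma>\<^sub>4\<close>, carried over to \<open>G / \<gamma>\<^sub>5\<close> through representatives in \<open>G\<close>.\<close>
    have noncentral: "\<exists>c\<in>lower_central (?Q 5) 2. commutator (?Q 5) c b \<notin> lower_central (?Q 5) 4"
      if b: "b \<in> carrier (?Q 5)" "b \<notin> lower_central (?Q 5) 2" for b
    proof -
      obtain b' where b': "b' \<in> carrier G" "b = lower_central G 5 #>\<^bsub>G\<^esub> b'"
        using b(1) by (auto simp: carrier_FactGroup)
      have "b' \<notin> lower_central G 2"
        using b(2) b' G.coset_mem_lower_central_quotient_iff[of 2 5 b'] by simp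
      hence h1: "lower_central G 4 #>\<^bsub>G\<^esub> b' \<notin> lower_central (?Q 4) 2"
        using b'(1) G.coset_mem_lower_central_quotient_iff[of 2 4 b'] by simp
      have h2: "lower_central G 4 #>\<^bsub>G\<^esub> b' \<in> carrier (?Q 4)" using b'(1) by (rule q4.hom_closed)
      have h3: "card (lower_central (?Q 4) 3) = p ^ 2" using rQ rp by simp
      have "\<exists>d\<in>lower_central (?Q 4) 2.
          commutator (?Q 4) d (lower_central G 4 #>\<^bsub>G\<^esub> b') \<noteq> \<one>\<^bsub>?Q 4\<^esub>"
        by (rule group.card_lower_central_3_dvd_prime_square(2)[OF grpQ finQ p
              G.lower_central_quotient_trivial ordQ card2 h3 h2 h1]) simp_all
      then obtain d where d: "d \<in> lower_central (?Q 4) 2"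
          "commutator (?Q 4) d (lower_central G 4 #>\<^bsub>G\<^esub> b') \<noteq> \<one>\<^bsub>?Q 4\<^esub>"
        by blast
      obtain c where c: "c \<in> lower_central G 2" "d = lower_central G 4 #>\<^bsub>G\<^esub> c"
        using d(1) unfolding G.coset_hom_lower_central(2) by blast
      have cc: "c \<in> carrier G" using c(1) by (rule G.lower_central_closed)
      have "commutator G c b' \<notin> lower_central G 4"
      proof
        assume "commutator G c b' \<in> lower_central G 4"
        hence "lower_central G 4 #>\<^bsub>G\<^esub> commutator G c b' = lower_central G 4"
          using normal.coset_eq_one_iff[OF G.lower_central_normal] cc b'(1) by simp
        thus False using d(2) c(2) q4.image_commutator[OF cc b'(1)] by simp
      qed
      hence "lower_central G 5 #>\<^bsub>G\<^esub> commutator G c b' \<notin> lower_central (?Q 5) 4"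
        using G.coset_mem_lower_central_quotient_iff[of 4 5 "commutator G c b'"] cc b'(1) by simp
      hence "commutator (?Q 5) (lower_central G 5 #>\<^bsub>G\<^esub> c) b \<notin> lower_central (?Q 5) 4"
        using q5.image_commutator[OF cc b'(1)] b'(2) by simp
      thus ?thesis using c(1) unfolding G.coset_hom_lower_central(2) by blast
    qed
    have "\<exists>\<mu>. linear_character (?Q 5) (lower_central (?Q 5) 2) \<mu> \<and>
        group.stabilizer_of_character (?Q 5) (lower_central (?Q 5) 2) \<mu> = lower_central (?Q 5) 2"
      by (rule group.exists_character_with_trivial_stabilizer[OF grpQ finQ p
            G.lower_central_quotient_trivial nontriv ordQ card2 noncentral]) simp_all
    then obtain \<mu> where \<mu>: "linear_character (?Q 5) (lower_central (?Q 5) 2) \<mu>"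
      and stab: "q5.H.stabilizer_of_character (lower_central (?Q 5) 2) \<mu> = lower_central (?Q 5) 2" by blast
    have "\<exists>\<rho>. irreducible_representation (?Q 5) (card (rcosets\<^bsub>?Q 5\<^esub> lower_central (?Q 5) 2)) \<rho>"
    proof (rule q5.H.exists_irreducible_representation_of_degree_index[OF finQ q5.H.lower_central_normal \<mu>])
      fix x assume "x \<in> carrier (?Q 5)" "x \<notin> lower_central (?Q 5) 2"
      thus "\<exists>y\<in>lower_central (?Q 5) 2. \<mu> (x \<otimes>\<^bsub>?Q 5\<^esub> y \<otimes>\<^bsub>?Q 5\<^esub> inv\<^bsub>?Q 5\<^esub> x) \<noteq> \<mu> y"
        using stab unfolding q5.H.stabilizer_of_character_def by blast
    qed
    moreover have "card (rcosets\<^bsub>?Q 5\<^esub> lower_central (?Q 5) 2) = p ^ 2"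
    proof -
      have "card (rcosets\<^bsub>?Q 5\<^esub> lower_central (?Q 5) 2) * card (lower_central (?Q 5) 2)
          = p ^ 2 * card (lower_central (?Q 5) 2)"
        using q5.H.lagrange[OF q5.H.lower_central_subgroup] ordQ[of 5] by simp
      moreover have "card (lower_central (?Q 5) 2) > 0"
        using subgroup.finite_imp_card_positive[OF q5.H.lower_central_subgroup finQ] .
      ultimately show ?thesis by simp
    qed
    ultimately obtain \<rho> where \<rho>: "irreducible_representation (?Q 5) (p ^ 2) \<rho>" by auto
    have "(\<lambda>x. lower_central G 5 #>\<^bsub>G\<^esub> x) ` carrier G = carrier (?Q 5)" by (simp add: carrier_FactGroup)
    from q5.irreducible_representation_pullback[OF this \<rho>]
    show ?thesis by (rule irreducible_representation_imp_character[OF G.is_group])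
  qed
  show ?thesis using first second unfolding r_def by blast
qed

end
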